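(* For every integer $n\ge 2$, $$C(n) < 6n-0.695\,n^{2/3}.$$
   Context: A packing of unit balls in $\mathbb{E}^3$ is a family of closed unit balls with pairwise disjoint interiors. The contact number $C(\mathcal{P})$ of a finite packing $\mathcal{P}$ is the number of unordered pairs of its balls that touch (i.e. whose centers are at distance exactly $2$). $C(n)$ denotes the maximum of $C(\mathcal{P})$ over all packings $\mathcal{P}$ of $n$ unit balls in $\mathbb{E}^3$. *)

theory Defs
  imports "HOL-Analysis.Analysis"
begin

text \<open>A finite packing of closed unit balls in Euclidean 3-space, represented by the set
of centers: the closed unit balls have pairwise disjoint interiors.\<close>
definition unit_ball_packing :: "(real^3) set \<Rightarrow> bool" where
  "unit_ball_packing P \<longleftrightarrow> finite P \<and>
     (\<forall>p\<in>P. \<forall>q\<in>P. p \<noteq> q \<longrightarrow> ball p 1 \<inter> ball q 1 = {})"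

definition contact_number :: "(real^3) set \<Rightarrow> nat" where
  "contact_number P = card {{p, q} | p q. p \<in> P \<and> q \<in> P \<and> dist p q = 2}"

definition C :: "nat \<Rightarrow> nat" where
  "C n = Max {contact_number P | P. unit_ball_packing P \<and> card P = n}"

end

theory Submission
  imports Defs
begin

text \<open>
  Enlarge all balls of the packing to radius \<open>2\<close>. If a point of the enlarged sphere around \<open>p\<close> is
  not covered by the other enlarged balls, then its direction makes an angle greater than \<open>60\<close> degrees
  with every contact direction of \<open>p\<close>. Since there are no \<open>13\<close> unit vectors with pairwise angles at least
  \<open>60\<close> degrees, a centre with \<open>12\<close> contacts exposes nothing, and a centre with \<open>d\<close> contacts exposes
  at most the fraction \<open>0.17 (12 - d)\<close> of its sphere: for \<open>d = 11\<close> any two exposed directions form an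
  angle less than \<open>60\<close> degrees, so they all lie in a small cap, and for \<open>d \<le> 10\<close> it suffices to remove
  the caps of angular radius \<open>30\<close> degrees around the contact directions.
  The volume gained when the radius grows from \<open>2\<close> to \<open>2.1\<close> is therefore bounded above in terms
  of \<open>\<Sum>p. 12 - d(p) = 12 n - 2 C\<close>; by the Brunn-Minkowski inequality it is at least
  \<open>0.3 n\<^sup>2\<^sup>/\<^sup>3\<close> unit ball volumes.

  The kissing number bound uses Musin's extension of Delsarte's method: a polynomial kernel
  that is a nonnegative combination of Legendre polynomials with constant term \<open>1\<close> has sum at least \<open>N\<^sup>2\<close>
  over \<open>N\<close> points, while each row sums to less than \<open>13\<close>, where positive values away from the diagonal
  come only from at most three nearly antipodal points.
\<close>

subsection \<open>The test polynomial\<close>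

text \<open>
  In terms of Legendre polynomials, \<open>kpoly = 1 + 71/40 P\<^sub>1 + 1753/500 P\<^sub>2 + 1737/1000 P\<^sub>3 + 249/125 P\<^sub>4 +
  107/250 P\<^sub>9\<close>; the coefficients are a rounded solution of a linear program. The inequalities for it are
  certified by nonnegative Bernstein coefficients on subintervals.
\<close>

definition kpoly :: "real \<Rightarrow> real" where
  "kpoly t = 260117/6400 * t ^ 9 - 137709/1600 * t ^ 7 + 963963/16000 * t ^ 5 + 1743/200 * t ^ 4 - 17769/1600 * t ^ 3 - 2211/1000 * t ^ 2 + 7129/32000 * t - 3/500"

text \<open>The left end lies just below -1/sqrt 2, so that at most three points of a configuration
  can lie beyond it as seen from a given one. In a row sum of the kernel, everything else off the
  diagonal may then be dropped.\<close>

lemma kpoly_nonpos: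
  fixes t :: real
  assumes "-177/250 \<le> t" "t \<le> 1/2"
  shows "kpoly t \<le> 0"
proof -
  have c1: ?thesis if "-177/250 \<le> t" "t \<le> -41/100"
  proof -
    define x y where "x = t + 177/250" and "y = -41/100 - t"
    have "x \<ge> 0" "y \<ge> 0"
      using that by (auto simp: x_def y_def)
    \<comment> \<open>Since \<open>x + y\<close> is the length of the subinterval, this is the
      Bernstein form of degree 9, with binomial coefficients and powers of the length absorbed into
      the constants. The later certificates have the same shape.\<close>
    have "- kpoly t = 25250843031258520194858/904932996990504783725 * y^9
      + 8240664251268870167337013/180986599398100956745 * x * y^8
      + 8841500508455650687637458/36197319879620191349 * x^2 * y^7
      + 18964800108697390622508665/36197319879620191349 * x^3 * y^6
      + 84006571388506972922611675/144789279518480765396 * x^4 * y^5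
      + 101780371944923155025701375/289578559036961530792 * x^5 * y^4
      + 32013361317006056468388125/289578559036961530792 * x^6 * y^3
      + 8167047567157637445303125/579157118073923061584 * x^7 * y^2
      + 456872302049861579703125/4633256944591384492672 * x^8 * y
      + 512452076260061987265625/9266513889182768985344 * x^9"
      unfolding kpoly_def x_def y_def by algebra
    also have "\<dots> \<ge> 0"
      using \<open>x \<ge> 0\<close> \<open>y \<ge> 0\<close> by (intro add_nonneg_nonneg mult_nonneg_nonneg zero_le_power) simp_all
    finally show ?thesis by simp
  qed
  have c2: ?thesis if "-41/100 \<le> t" "t \<le> 1/25"
  proof -
    define x y where "x = t + 41/100" and "y = 1/25 - t"
    have "x \<ge> 0" "y \<ge> 0"
      using that by (auto simp: x_def y_def)
    have "- kpoly t = 6559386576128793437/4842756112500000000 * y^9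
      + 3625524003624592843/134521003125000000 * x * y^8
      + 715737407574236746/700630224609375 * x^2 * y^7
      + 35755738304733092246/6305672021484375 * x^3 * y^6
      + 25418551657490313488/2101890673828125 * x^4 * y^5
      + 2769754544469420992/233543408203125 * x^5 * y^4
      + 34223213828626363136/6305672021484375 * x^6 * y^3
      + 2011475376433650688/2101890673828125 * x^7 * y^2
      + 9069534001209344/700630224609375 * x^8 * y
      + 32716108188680192/18917016064453125 * x^9"
      unfolding kpoly_def x_def y_def by algebra
    also have "\<dots> \<ge> 0"
      using \<open>x \<ge> 0\<close> \<open>y \<ge> 0\<close> by (intro add_nonneg_nonneg mult_nonneg_nonneg zero_le_power) simp_all
    finally show ?thesis by simp
  qed
  have c3: ?thesis if "1/25 \<le> t" "t \<le> 1/2"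
  proof -
    define x y where "x = t - 1/25" and "y = 1/2 - t"
    have "x \<ge> 0" "y \<ge> 0"
      using that by (auto simp: x_def y_def)
    have "- kpoly t = 63898648806016/45028816536575 * y^9
      + 26962033640672/1801152661463 * x * y^8
      + 1537780763985400/1801152661463 * x^2 * y^7
      + 11888627786487500/1801152661463 * x^3 * y^6
      + 38427143990368750/1801152661463 * x^4 * y^5
      + 63755549404296875/1801152661463 * x^5 * y^4
      + 225752235712890625/7204610645852 * x^6 * y^3
      + 100264267138671875/7204610645852 * x^7 * y^2
      + 564113651123046875/230547540667264 * x^8 * y
      + 580291748046875/461095081334528 * x^9"
      unfolding kpoly_def x_def y_def by algebra
    also have "\<dots> \<ge> 0"
      using \<open>x \<ge> 0\<close> \<open>y \<ge> 0\<close> by (intro add_nonneg_nonneg mult_nonneg_nonneg zero_le_power) simp_all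
    finally show ?thesis by simp
  qed
  show ?thesis
    using assms c1 c2 c3 by (metis linear)
qed

text \<open>Covers the case of a single nearly antipodal point.\<close>

lemma kpoly_neg_le:
  fixes t :: real
  assumes "7/10 \<le> t" "t \<le> 1"
  shows "kpoly (- t) \<le> 64/25"
proof -
  have c1: ?thesis if "7/10 \<le> t" "t \<le> 99/100"
  proof -
    define x y where "x = t - 7/10" and "y = 99/100 - t"
    have "x \<ge> 0" "y \<ge> 0"
      using that by (auto simp: x_def y_def)
    have "64/25 - kpoly (- t) = 2581487650190468750/14507145975869 * y^9
      + 22528549081072609375/14507145975869 * x * y^8
      + 85330190064104243750/14507145975869 * x^2 * y^7
      + 181847006354356129375/14507145975869 * x^3 * y^6
      + 942754812619588324625/58028583903476 * x^4 * y^5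
      + 1491144666931242848225/116057167806952 * x^5 * y^4
      + 674146017153352300255/116057167806952 * x^6 * y^3
      + 284883053749262705203/232114335613904 * x^7 * y^2
      + 456296572559312002571/9284573424556160 * x^8 * y
      + 53480734948956085183/92845734245561600 * x^9"
      unfolding kpoly_def x_def y_def by algebra
    also have "\<dots> \<ge> 0"
      using \<open>x \<ge> 0\<close> \<open>y \<ge> 0\<close> by (intro add_nonneg_nonneg mult_nonneg_nonneg zero_le_power) simp_all
    finally show ?thesis by simp
  qed
  have c2: ?thesis if "99/100 \<le> t" "t \<le> 1"
  proof -
    define x y where "x = t - 99/100" and "y = 1 - t"
    have "x \<ge> 0" "y \<ge> 0"
      using that by (auto simp: x_def y_def)
    have "64/25 - kpoly (- t) = 53480734948956085183/6400 * y^9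
      + 3405804382974145853/64 * x * y^8
      + 139643515848605350 * x^2 * y^7
      + 190265272513358750 * x^3 * y^6
      + 136277034737950000 * x^4 * y^5
      + 42732886925000000 * x^5 * y^4
      + 4087787500000000 * x^6 * y^3
      + 7960850000000000 * x^7 * y^2
      + 7810000000000000 * x^8 * y
      + 2000000000000000 * x^9"
      unfolding kpoly_def x_def y_def by algebra
    also have "\<dots> \<ge> 0"
      using \<open>x \<ge> 0\<close> \<open>y \<ge> 0\<close> by (intro add_nonneg_nonneg mult_nonneg_nonneg zero_le_power) simp_all
    finally show ?thesis by simp
  qed
  show ?thesis
    using assms c1 c2 by (metis linear)
qed

text \<open>For t = cos a the cubic is 32/25 + 227/125 * cos (3 a). Two directions at angles a and b
  from an axis, both below 45 degrees, and at least 60 degrees apart have a + b at least 60 degrees,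
  so cos (3 a) + cos (3 b) is at most 0 and two such bounds add up to at most 64/25.\<close>

lemma kpoly_neg_le_cubic:
  fixes t :: real
  assumes "177/250 \<le> t" "t \<le> 97/100"
  shows "kpoly (- t) \<le> 32/25 - 681/125 * t + 908/125 * t ^ 3"
proof -
  have c1: ?thesis if "177/250 \<le> t" "t \<le> 22/25"
  proof -
    define x y where "x = t - 177/250" and "y = 22/25 - t"
    have "x \<ge> 0" "y \<ge> 0"
      using that by (auto simp: x_def y_def)
    have "(32/25 - 681/125 * t + 908/125 * t ^ 3) - kpoly (- t) = 31488721515629260097429/3216592716395795200 * y^9
      + 572555156437164026553223/160829635819789760 * x * y^8
      + 209206785947290675694131/8041481790989488 * x^2 * y^7
      + 163222082039257914206385/2010370447747372 * x^3 * y^6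
      + 559853385425761308115175/4020740895494744 * x^4 * y^5
      + 142184273699147373312625/1005185223873686 * x^5 * y^4
      + 42883786866152772624375/502592611936843 * x^6 * y^3
      + 14505915849373720662500/502592611936843 * x^7 * y^2
      + 2396161460298224078125/502592611936843 * x^8 * y
      + 149178093498502187500/502592611936843 * x^9"
      unfolding kpoly_def x_def y_def by algebra
    also have "\<dots> \<ge> 0"
      using \<open>x \<ge> 0\<close> \<open>y \<ge> 0\<close> by (intro add_nonneg_nonneg mult_nonneg_nonneg zero_le_power) simp_all
    finally show ?thesis by simp
  qed
  have c2: ?thesis if "22/25 \<le> t" "t \<le> 23/25"
  proof -
    define x y where "x = t - 22/25" and "y = 23/25 - t"
    have "x \<ge> 0" "y \<ge> 0"
      using that by (auto simp: x_def y_def)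
    have "(32/25 - 681/125 * t + 908/125 * t ^ 3) - kpoly (- t) = 477369899195207/3200 * y^9
      + 7024570938910259/6400 * x * y^8
      + 2758832891385803/800 * x^2 * y^7
      + 4791814452132063/800 * x^3 * y^6
      + 619664919402061/100 * x^4 * y^5
      + 380153555121899/100 * x^5 * y^4
      + 31753412500686/25 * x^6 * y^3
      + 71377886786111/400 * x^7 * y^2
      + 1261520036903/200 * x^8 * y
      + 347495944989/100 * x^9"
      unfolding kpoly_def x_def y_def by algebra
    also have "\<dots> \<ge> 0"
      using \<open>x \<ge> 0\<close> \<open>y \<ge> 0\<close> by (intro add_nonneg_nonneg mult_nonneg_nonneg zero_le_power) simp_all
    finally show ?thesis by simp
  qed
  have c3: ?thesis if "23/25 \<le> t" "t \<le> 97/100"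
  proof -
    define x y where "x = t - 23/25" and "y = 97/100 - t"
    have "x \<ge> 0" "y \<ge> 0"
      using that by (auto simp: x_def y_def)
    have "(32/25 - 681/125 * t + 908/125 * t ^ 3) - kpoly (- t) = 22773494250799104/48828125 * y^9
      + 409491397867134976/48828125 * x * y^8
      + 5047649736124734464/48828125 * x^2 * y^7
      + 26987294463789670656/48828125 * x^3 * y^6
      + 76187978531933111744/48828125 * x^4 * y^5
      + 127020459556438293904/48828125 * x^5 * y^4
      + 130299568130501480226/48828125 * x^6 * y^3
      + 81201069033543834514/48828125 * x^7 * y^2
      + 1811620347830697458459/3125000000 * x^8 * y
      + 1087033184770655870389/12500000000 * x^9"
      unfolding kpoly_def x_def y_def by algebra
    also have "\<dots> \<ge> 0"
      using \<open>x \<ge> 0\<close> \<open>y \<ge> 0\<close> by (intro add_nonneg_nonneg mult_nonneg_nonneg zero_le_power) simp_all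
    finally show ?thesis by simp
  qed
  show ?thesis
    using assms c1 c2 c3 by (metis linear)
qed

text \<open>Serves the case of three points: a quadratic majorant summed over them depends only on
  the sum and the sum of squares of their inner products with the axis, and these two are linked by
  the separation of the points.\<close>

lemma kpoly_neg_le_quadratic:
  fixes t :: real
  assumes "7/10 \<le> t" "t \<le> 19/20"
  shows "kpoly (- t) \<le> 3083/500 - 114/5 * t + 3991/200 * t ^ 2"
proof -
  define x y where "x = t - 7/10" and "y = 19/20 - t"
  have "x \<ge> 0" "y \<ge> 0"
    using assms by (auto simp: x_def y_def)
  have "(3083/500 - 114/5 * t + 3991/200 * t ^ 2) - kpoly (- t) = 69601922438/48828125 * y^9
      + 9287275005207/48828125 * x * y^8
      + 69067853757838/48828125 * x^2 * y^7
      + 216895924155487/48828125 * x^3 * y^6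
      + 1454992599704037/195312500 * x^4 * y^5
      + 2771116046637529/390625000 * x^5 * y^4
      + 1481619725778931/390625000 * x^6 * y^3
      + 875084345446083/781250000 * x^7 * y^2
      + 1563876013776011/6250000000 * x^8 * y
      + 778844324026543/12500000000 * x^9"
    unfolding kpoly_def x_def y_def by algebra
  also have "\<dots> \<ge> 0"
    using \<open>x \<ge> 0\<close> \<open>y \<ge> 0\<close> by (intro add_nonneg_nonneg mult_nonneg_nonneg zero_le_power) simp_all
  finally show ?thesis by simp
qed

subsection \<open>Positive semidefinite kernels on the sphere\<close>

text \<open>The quadratic form of the kernel is tested at the all-ones vector only, since the
  kernels enter through their total sums.\<close>

definition psd_on :: "'a set \<Rightarrow> ('a \<Rightarrow> 'a \<Rightarrow> real) \<Rightarrow> bool" where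
  "psd_on X K \<longleftrightarrow> 0 \<le> (\<Sum>x\<in>X. \<Sum>y\<in>X. K x y)"

lemma psd_on_add: "psd_on X K \<Longrightarrow> psd_on X L \<Longrightarrow> psd_on X (\<lambda>x y. K x y + L x y)"
  by (simp add: psd_on_def sum.distrib)

lemma psd_on_scale: "0 \<le> c \<Longrightarrow> psd_on X K \<Longrightarrow> psd_on X (\<lambda>x y. c * K x y)"
  by (simp add: psd_on_def flip: sum_distrib_left)

lemma psd_on_cong:
  assumes "psd_on X K" and "\<And>x y. x \<in> X \<Longrightarrow> y \<in> X \<Longrightarrow> L x y = K x y"
  shows "psd_on X L"
  using assms by (simp add: psd_on_def)

text \<open>The double sum is the squared modulus of the single sum of
  \<open>w x * z x ^ m\<close>.\<close>

lemma psd_on_Re_power: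
  fixes w :: "'a \<Rightarrow> real" and z :: "'a \<Rightarrow> complex"
  shows "psd_on X (\<lambda>x y. w x * w y * Re ((z x * cnj (z y)) ^ m))"
proof -
  define S where "S = (\<Sum>x\<in>X. of_real (w x) * z x ^ m)"
  have "S * cnj S = (\<Sum>x\<in>X. \<Sum>y\<in>X. (of_real (w x) * z x ^ m) * cnj (of_real (w y) * z y ^ m))"
    unfolding S_def cnj_sum sum_product ..
  also have "\<dots> = (\<Sum>x\<in>X. \<Sum>y\<in>X. of_real (w x * w y) * (z x * cnj (z y)) ^ m)"
    by (intro sum.cong refl) (simp add: power_mult_distrib mult_ac)
  finally have "Re (S * cnj S) = (\<Sum>x\<in>X. \<Sum>y\<in>X. Re (of_real (w x * w y) * (z x * cnj (z y)) ^ m))"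
    by simp
  also have "\<dots> = (\<Sum>x\<in>X. \<Sum>y\<in>X. w x * w y * Re ((z x * cnj (z y)) ^ m))"
    by (intro sum.cong refl) (simp flip: of_real_mult)
  finally have "(\<Sum>x\<in>X. \<Sum>y\<in>X. w x * w y * Re ((z x * cnj (z y)) ^ m)) = Re (S * cnj S)"
    by simp
  also have "\<dots> \<ge> 0"
    by (simp add: complex_mult_cnj)
  finally show ?thesis
    unfolding psd_on_def .
qed

text \<open>A complex number satisfies z^2 = 2 (Re z) z - |z|^2. With real part \<open>s\<close> and
  squared modulus \<open>p\<close> this is the recurrence of the homogenized Chebyshev polynomials,
  which the following lemmas unroll up to degree 9.\<close>

lemma Re_power_rec:
  assumes "n \<ge> 2"
  shows "Re (z ^ n) = 2 * Re z * Re (z ^ (n - 1)) - (cmod z)\<^sup>2 * Re (z ^ (n - 2))"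
proof -
  have step: "Re (z * (z * w)) = 2 * Re z * Re (z * w) - (cmod z)\<^sup>2 * Re w" for w
    unfolding cmod_power2 times_complex.sel by algebra
  obtain m where "n = Suc (Suc m)"
    using assms by (metis add_2_eq_Suc le_Suc_ex)
  then show ?thesis
    using step[of "z ^ m"] by simp
qed

lemma Re_power_2:
  assumes "Re z = s" "(cmod z)\<^sup>2 = p"
  shows "Re (z^2) = 2 * s^2 - p"
  using Re_power_rec[of 2 z] assms by (simp add: power2_eq_square)

lemma Re_power_3:
  assumes "Re z = s" "(cmod z)\<^sup>2 = p"
  shows "Re (z^3) = 4 * s^3 - 3 * s * p"
proof -
  have "Re (z^3) = 2 * s * Re (z^2) - p * s"
    using Re_power_rec[of 3 z] assms by simp
  also have "\<dots> = 4 * s^3 - 3 * s * p"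
    unfolding Re_power_2[OF assms] by algebra
  finally show ?thesis .
qed

lemma Re_power_4:
  assumes "Re z = s" "(cmod z)\<^sup>2 = p"
  shows "Re (z^4) = 8 * s^4 - 8 * s^2 * p + p^2"
proof -
  have "Re (z^4) = 2 * s * Re (z^3) - p * Re (z^2)"
    using Re_power_rec[of 4 z] assms by simp
  also have "\<dots> = 8 * s^4 - 8 * s^2 * p + p^2"
    unfolding Re_power_3[OF assms] Re_power_2[OF assms] by algebra
  finally show ?thesis .
qed

lemma Re_power_5:
  assumes "Re z = s" "(cmod z)\<^sup>2 = p"
  shows "Re (z^5) = 16 * s^5 - 20 * s^3 * p + 5 * s * p^2"
proof -
  have "Re (z^5) = 2 * s * Re (z^4) - p * Re (z^3)"
    using Re_power_rec[of 5 z] assms by simp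
  also have "\<dots> = 16 * s^5 - 20 * s^3 * p + 5 * s * p^2"
    unfolding Re_power_4[OF assms] Re_power_3[OF assms] by algebra
  finally show ?thesis .
qed

lemma Re_power_6:
  assumes "Re z = s" "(cmod z)\<^sup>2 = p"
  shows "Re (z^6) = 32 * s^6 - 48 * s^4 * p + 18 * s^2 * p^2 - p^3"
proof -
  have "Re (z^6) = 2 * s * Re (z^5) - p * Re (z^4)"
    using Re_power_rec[of 6 z] assms by simp
  also have "\<dots> = 32 * s^6 - 48 * s^4 * p + 18 * s^2 * p^2 - p^3"
    unfolding Re_power_5[OF assms] Re_power_4[OF assms] by algebra
  finally show ?thesis .
qed

lemma Re_power_7:
  assumes "Re z = s" "(cmod z)\<^sup>2 = p"
  shows "Re (z^7) = 64 * s^7 - 112 * s^5 * p + 56 * s^3 * p^2 - 7 * s * p^3"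
proof -
  have "Re (z^7) = 2 * s * Re (z^6) - p * Re (z^5)"
    using Re_power_rec[of 7 z] assms by simp
  also have "\<dots> = 64 * s^7 - 112 * s^5 * p + 56 * s^3 * p^2 - 7 * s * p^3"
    unfolding Re_power_6[OF assms] Re_power_5[OF assms] by algebra
  finally show ?thesis .
qed

lemma Re_power_8:
  assumes "Re z = s" "(cmod z)\<^sup>2 = p"
  shows "Re (z^8) = 128 * s^8 - 256 * s^6 * p + 160 * s^4 * p^2 - 32 * s^2 * p^3 + p^4"
proof -
  have "Re (z^8) = 2 * s * Re (z^7) - p * Re (z^6)"
    using Re_power_rec[of 8 z] assms by simp
  also have "\<dots> = 128 * s^8 - 256 * s^6 * p + 160 * s^4 * p^2 - 32 * s^2 * p^3 + p^4"
    unfolding Re_power_7[OF assms] Re_power_6[OF assms] by algebra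
  finally show ?thesis .
qed

lemma Re_power_9:
  assumes "Re z = s" "(cmod z)\<^sup>2 = p"
  shows "Re (z^9) = 256 * s^9 - 576 * s^7 * p + 432 * s^5 * p^2 - 120 * s^3 * p^3 + 9 * s * p^4"
proof -
  have "Re (z^9) = 2 * s * Re (z^8) - p * Re (z^7)"
    using Re_power_rec[of 9 z] assms by simp
  also have "\<dots> = 256 * s^9 - 576 * s^7 * p + 432 * s^5 * p^2 - 120 * s^3 * p^3 + 9 * s * p^4"
    unfolding Re_power_8[OF assms] Re_power_7[OF assms] by algebra
  finally show ?thesis .
qed

lemmas Re_powers = Re_power_2 Re_power_3 Re_power_4 Re_power_5 Re_power_6 Re_power_7 Re_power_8 Re_power_9

section \<open>Legendre kernels in coordinates along a fixed axis\<close>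

definition cvec :: "real^3 \<Rightarrow> complex" where
  "cvec x = Complex (x$1) (x$2)"

lemma inner_cvec: "x \<bullet> y = x$3 * y$3 + Re (cvec x * cnj (cvec y))"
  by (simp add: cvec_def inner_vec_def sum_3)

lemma cmod_cvec_mult:
  assumes "norm x = 1" "norm y = 1"
  shows "(cmod (cvec x * cnj (cvec y)))\<^sup>2 = (1 - (x$3)^2) * (1 - (y$3)^2)"
proof -
  have "(cmod (cvec z))\<^sup>2 = 1 - (z$3)^2" if "norm z = 1" for z
    unfolding cmod_power2 cvec_def using that
    by (simp add: norm_eq_1 inner_vec_def sum_3 power2_eq_square)
  with assms show ?thesis
    by (simp add: norm_mult power_mult_distrib)
qed

text \<open>
  The addition theorem for Legendre polynomials: for unit vectors with third coordinates \<open>u\<close> and \<open>v\<close> and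
  projections \<open>z\<close>, \<open>w\<close> to the complex plane, \<open>s\<close> stands for \<open>Re (z * cnj w)\<close> and \<open>p\<close> for its squared modulus,
  and the last factors are \<open>Re ((z * cnj w)\<^sup>m)\<close>.
\<close>

lemma legendre2_addition:
  fixes u v s p :: real
  assumes "p = (1 - u^2) * (1 - v^2)"
  shows "3/2 * (u * v + s)^2 - 1/2 =
    1/4 * ((3 * u^2 - 1) * (3 * v^2 - 1) * 1) +
    3 * (u * v * s) +
    3/4 * (1 * 1 * (2 * s^2 - p))"
  unfolding assms by algebra

text \<open>The addition formula splits the kernel, with positive coefficients, into terms covered
  by \<open>psd_on_Re_power\<close>. Up to scale, the weight of the m-th term is the m-th derivative
  of the Legendre polynomial at the third coordinate; the factor (1 - u^2)^(m/2) of the associated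
  Legendre function is the modulus of \<open>cvec x ^ m\<close>. Degrees 3, 4 and 9 go the same
  way.\<close>

lemma psd_on_legendre2:
  fixes X :: "(real^3) set"
  assumes "X \<subseteq> sphere 0 1"
  shows "psd_on X (\<lambda>x y. 3/2 * (x \<bullet> y)^2 - 1/2)"
proof -
  have "psd_on X (\<lambda>x y.
    1/4 * ((3 * (x$3)^2 - 1) * (3 * (y$3)^2 - 1) * Re ((cvec x * cnj (cvec y))^0)) +
    3 * ((x$3) * (y$3) * Re ((cvec x * cnj (cvec y))^1)) +
    3/4 * (1 * 1 * Re ((cvec x * cnj (cvec y))^2)))" (is "psd_on X ?K")
    by (intro psd_on_add psd_on_scale psd_on_Re_power psd_on_Re_power[of _ "\<lambda>_. 1", simplified]) simp_all
  moreover have "3/2 * (x \<bullet> y)^2 - 1/2 = ?K x y" if "x \<in> X" "y \<in> X" for x y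
    unfolding inner_cvec Re_powers[OF refl refl] power_0 power_one_right one_complex.sel
    using that assms by (intro legendre2_addition cmod_cvec_mult) auto
  ultimately show ?thesis
    by (rule psd_on_cong)
qed

lemma legendre3_addition:
  fixes u v s p :: real
  assumes "p = (1 - u^2) * (1 - v^2)"
  shows "5/2 * (u * v + s)^3 - 3/2 * (u * v + s) =
    1/4 * ((5 * u^3 - 3 * u) * (5 * v^3 - 3 * v) * 1) +
    3/8 * ((5 * u^2 - 1) * (5 * v^2 - 1) * s) +
    15/4 * (u * v * (2 * s^2 - p)) +
    5/8 * (1 * 1 * (4 * s^3 - 3 * s * p))"
  unfolding assms by algebra

lemma psd_on_legendre3:
  fixes X :: "(real^3) set"
  assumes "X \<subseteq> sphere 0 1"
  shows "psd_on X (\<lambda>x y. 5/2 * (x \<bullet> y)^3 - 3/2 * (x \<bullet> y))"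
proof -
  have "psd_on X (\<lambda>x y.
    1/4 * ((5 * (x$3)^3 - 3 * (x$3)) * (5 * (y$3)^3 - 3 * (y$3)) * Re ((cvec x * cnj (cvec y))^0)) +
    3/8 * ((5 * (x$3)^2 - 1) * (5 * (y$3)^2 - 1) * Re ((cvec x * cnj (cvec y))^1)) +
    15/4 * ((x$3) * (y$3) * Re ((cvec x * cnj (cvec y))^2)) +
    5/8 * (1 * 1 * Re ((cvec x * cnj (cvec y))^3)))" (is "psd_on X ?K")
    by (intro psd_on_add psd_on_scale psd_on_Re_power psd_on_Re_power[of _ "\<lambda>_. 1", simplified]) simp_all
  moreover have "5/2 * (x \<bullet> y)^3 - 3/2 * (x \<bullet> y) = ?K x y" if "x \<in> X" "y \<in> X" for x y
    unfolding inner_cvec Re_powers[OF refl refl] power_0 power_one_right one_complex.sel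
    using that assms by (intro legendre3_addition cmod_cvec_mult) auto
  ultimately show ?thesis
    by (rule psd_on_cong)
qed

lemma legendre4_addition:
  fixes u v s p :: real
  assumes "p = (1 - u^2) * (1 - v^2)"
  shows "35/8 * (u * v + s)^4 - 15/4 * (u * v + s)^2 + 3/8 =
    1/64 * ((35 * u^4 - 30 * u^2 + 3) * (35 * v^4 - 30 * v^2 + 3) * 1) +
    5/8 * ((7 * u^3 - 3 * u) * (7 * v^3 - 3 * v) * s) +
    5/16 * ((7 * u^2 - 1) * (7 * v^2 - 1) * (2 * s^2 - p)) +
    35/8 * (u * v * (4 * s^3 - 3 * s * p)) +
    35/64 * (1 * 1 * (8 * s^4 - 8 * s^2 * p + p^2))"
  unfolding assms by algebra

lemma psd_on_legendre4:
  fixes X :: "(real^3) set"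
  assumes "X \<subseteq> sphere 0 1"
  shows "psd_on X (\<lambda>x y. 35/8 * (x \<bullet> y)^4 - 15/4 * (x \<bullet> y)^2 + 3/8)"
proof -
  have "psd_on X (\<lambda>x y.
    1/64 * ((35 * (x$3)^4 - 30 * (x$3)^2 + 3) * (35 * (y$3)^4 - 30 * (y$3)^2 + 3) * Re ((cvec x * cnj (cvec y))^0)) +
    5/8 * ((7 * (x$3)^3 - 3 * (x$3)) * (7 * (y$3)^3 - 3 * (y$3)) * Re ((cvec x * cnj (cvec y))^1)) +
    5/16 * ((7 * (x$3)^2 - 1) * (7 * (y$3)^2 - 1) * Re ((cvec x * cnj (cvec y))^2)) +
    35/8 * ((x$3) * (y$3) * Re ((cvec x * cnj (cvec y))^3)) +
    35/64 * (1 * 1 * Re ((cvec x * cnj (cvec y))^4)))" (is "psd_on X ?K")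
    by (intro psd_on_add psd_on_scale psd_on_Re_power psd_on_Re_power[of _ "\<lambda>_. 1", simplified]) simp_all
  moreover have "35/8 * (x \<bullet> y)^4 - 15/4 * (x \<bullet> y)^2 + 3/8 = ?K x y" if "x \<in> X" "y \<in> X" for x y
    unfolding inner_cvec Re_powers[OF refl refl] power_0 power_one_right one_complex.sel
    using that assms by (intro legendre4_addition cmod_cvec_mult) auto
  ultimately show ?thesis
    by (rule psd_on_cong)
qed

lemma legendre9_addition:
  fixes u v s p :: real
  assumes "p = (1 - u^2) * (1 - v^2)"
  shows "12155/128 * (u * v + s)^9 - 6435/32 * (u * v + s)^7 + 9009/64 * (u * v + s)^5 - 1155/32 * (u * v + s)^3 + 315/128 * (u * v + s) =
    1/16384 * ((12155 * u^9 - 25740 * u^7 + 18018 * u^5 - 4620 * u^3 + 315 * u) * (12155 * v^9 - 25740 * v^7 + 18018 * v^5 - 4620 * v^3 + 315 * v) * 1) +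
    45/16384 * ((2431 * u^8 - 4004 * u^6 + 2002 * u^4 - 308 * u^2 + 7) * (2431 * v^8 - 4004 * v^6 + 2002 * v^4 - 308 * v^2 + 7) * s) +
    495/2048 * ((221 * u^7 - 273 * u^5 + 91 * u^3 - 7 * u) * (221 * v^7 - 273 * v^5 + 91 * v^3 - 7 * v) * (2 * s^2 - p)) +
    1155/8192 * ((221 * u^6 - 195 * u^4 + 39 * u^2 - 1) * (221 * v^6 - 195 * v^4 + 39 * v^2 - 1) * (4 * s^3 - 3 * s * p)) +
    45045/4096 * ((17 * u^5 - 10 * u^3 + u) * (17 * v^5 - 10 * v^3 + v) * (8 * s^4 - 8 * s^2 * p + p^2)) +
    1287/8192 * ((85 * u^4 - 30 * u^2 + 1) * (85 * v^4 - 30 * v^2 + 1) * (16 * s^5 - 20 * s^3 * p + 5 * s * p^2)) +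
    2145/2048 * ((17 * u^3 - 3 * u) * (17 * v^3 - 3 * v) * (32 * s^6 - 48 * s^4 * p + 18 * s^2 * p^2 - p^3)) +
    6435/32768 * ((17 * u^2 - 1) * (17 * v^2 - 1) * (64 * s^7 - 112 * s^5 * p + 56 * s^3 * p^2 - 7 * s * p^3)) +
    109395/16384 * (u * v * (128 * s^8 - 256 * s^6 * p + 160 * s^4 * p^2 - 32 * s^2 * p^3 + p^4)) +
    12155/32768 * (1 * 1 * (256 * s^9 - 576 * s^7 * p + 432 * s^5 * p^2 - 120 * s^3 * p^3 + 9 * s * p^4))"
  unfolding assms by algebra

lemma psd_on_legendre9:
  fixes X :: "(real^3) set"
  assumes "X \<subseteq> sphere 0 1"
  shows "psd_on X (\<lambda>x y. 12155/128 * (x \<bullet> y)^9 - 6435/32 * (x \<bullet> y)^7 + 9009/64 * (x \<bullet> y)^5 - 1155/32 * (x \<bullet> y)^3 + 315/128 * (x \<bullet> y))"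
proof -
  have "psd_on X (\<lambda>x y.
    1/16384 * ((12155 * (x$3)^9 - 25740 * (x$3)^7 + 18018 * (x$3)^5 - 4620 * (x$3)^3 + 315 * (x$3)) * (12155 * (y$3)^9 - 25740 * (y$3)^7 + 18018 * (y$3)^5 - 4620 * (y$3)^3 + 315 * (y$3)) * Re ((cvec x * cnj (cvec y))^0)) +
    45/16384 * ((2431 * (x$3)^8 - 4004 * (x$3)^6 + 2002 * (x$3)^4 - 308 * (x$3)^2 + 7) * (2431 * (y$3)^8 - 4004 * (y$3)^6 + 2002 * (y$3)^4 - 308 * (y$3)^2 + 7) * Re ((cvec x * cnj (cvec y))^1)) +
    495/2048 * ((221 * (x$3)^7 - 273 * (x$3)^5 + 91 * (x$3)^3 - 7 * (x$3)) * (221 * (y$3)^7 - 273 * (y$3)^5 + 91 * (y$3)^3 - 7 * (y$3)) * Re ((cvec x * cnj (cvec y))^2)) +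
    1155/8192 * ((221 * (x$3)^6 - 195 * (x$3)^4 + 39 * (x$3)^2 - 1) * (221 * (y$3)^6 - 195 * (y$3)^4 + 39 * (y$3)^2 - 1) * Re ((cvec x * cnj (cvec y))^3)) +
    45045/4096 * ((17 * (x$3)^5 - 10 * (x$3)^3 + (x$3)) * (17 * (y$3)^5 - 10 * (y$3)^3 + (y$3)) * Re ((cvec x * cnj (cvec y))^4)) +
    1287/8192 * ((85 * (x$3)^4 - 30 * (x$3)^2 + 1) * (85 * (y$3)^4 - 30 * (y$3)^2 + 1) * Re ((cvec x * cnj (cvec y))^5)) +
    2145/2048 * ((17 * (x$3)^3 - 3 * (x$3)) * (17 * (y$3)^3 - 3 * (y$3)) * Re ((cvec x * cnj (cvec y))^6)) +
    6435/32768 * ((17 * (x$3)^2 - 1) * (17 * (y$3)^2 - 1) * Re ((cvec x * cnj (cvec y))^7)) +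
    109395/16384 * ((x$3) * (y$3) * Re ((cvec x * cnj (cvec y))^8)) +
    12155/32768 * (1 * 1 * Re ((cvec x * cnj (cvec y))^9)))" (is "psd_on X ?K")
    by (intro psd_on_add psd_on_scale psd_on_Re_power psd_on_Re_power[of _ "\<lambda>_. 1", simplified]) simp_all
  moreover have "12155/128 * (x \<bullet> y)^9 - 6435/32 * (x \<bullet> y)^7 + 9009/64 * (x \<bullet> y)^5 - 1155/32 * (x \<bullet> y)^3 + 315/128 * (x \<bullet> y) = ?K x y" if "x \<in> X" "y \<in> X" for x y
    unfolding inner_cvec Re_powers[OF refl refl] power_0 power_one_right one_complex.sel
    using that assms by (intro legendre9_addition cmod_cvec_mult) auto
  ultimately show ?thesis
    by (rule psd_on_cong)
qed

subsection \<open>The kissing number in dimension three\<close>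

lemma inner_unit_square_le:
  fixes e v :: "'a::real_inner"
  assumes "norm e = 1"
  shows "(e \<bullet> v)\<^sup>2 \<le> v \<bullet> v"
  using Cauchy_Schwarz_ineq[of e v] assms by (simp add: norm_eq_1)

lemma kpoly_pair:
  fixes e x y :: "'a::real_inner"
  assumes "norm e = 1" "norm x = 1" "norm y = 1"
    and xy: "x \<bullet> y \<le> 1/2"
    and t: "e \<bullet> x \<ge> 177/250" and u: "e \<bullet> y \<ge> 177/250"
  shows "kpoly (- (e \<bullet> x)) + kpoly (- (e \<bullet> y)) \<le> 64/25"
proof -
  define t u where "t = e \<bullet> x" and "u = e \<bullet> y"
  define g where "g = t^2 + u^2 - t * u"
  have bounds: "t \<ge> 177/250" "t \<le> 1" "u \<ge> 177/250" "u \<le> 1"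
    using assms norm_cauchy_schwarz[of e x] norm_cauchy_schwarz[of e y] by (auto simp: t_def u_def)
  have g_le: "g \<le> 3/4"
  proof -
    \<comment> \<open>Up to scale, these weights are the inverse of the extremal Gram matrix (1 on
      the diagonal, 1/2 off it) applied to (t, u). They are nonnegative, so
      \<open>x \<bullet> y\<close> may be replaced by its upper bound 1/2.\<close>
    define a b where "a = 2 * t - u" and "b = 2 * u - t"
    have ab: "a \<ge> 0" "b \<ge> 0"
      using bounds by (auto simp: a_def b_def)
    have "(2 * g)\<^sup>2 = (e \<bullet> (a *\<^sub>R x + b *\<^sub>R y))\<^sup>2"
      by (simp add: g_def a_def b_def t_def u_def inner_add_right power2_eq_square algebra_simps)
    also have "\<dots> \<le> (a *\<^sub>R x + b *\<^sub>R y) \<bullet> (a *\<^sub>R x + b *\<^sub>R y)"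
      using assms(1) by (rule inner_unit_square_le)
    also have "\<dots> = a^2 + b^2 + 2 * (a * b) * (x \<bullet> y)"
      using assms(2,3) by (simp add: norm_eq_1 inner_add_left inner_add_right inner_commute power2_eq_square algebra_simps)
    also have "\<dots> \<le> a^2 + b^2 + 2 * (a * b) * (1/2)"
      using xy ab by (intro add_left_mono mult_left_mono) auto
    also have "\<dots> = 3 * g"
      unfolding a_def b_def g_def by algebra
    finally have "4 * g * g \<le> 3 * g"
      by (simp add: power2_eq_square)
    then show ?thesis
      using mult_le_cancel_right_pos[of g "4 * g" 3] by (cases "g > 0") auto
  qed
  \<comment> \<open>At the corner v = 97/100, w = 177/250 the form is 188851/250000 > 3/4, and it
    only grows beyond. This brings \<open>t\<close> and \<open>u\<close> into the range of the cubic
    majorant.\<close>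
  have le: "v \<le> 97/100" if "v^2 + w^2 - v * w \<le> 3/4" "w \<ge> 177/250" for v w :: real
  proof (rule ccontr)
    define a b where "a = v - 97/100" and "b = w - 177/250"
    assume "\<not> v \<le> 97/100"
    with that(2) have ab: "a \<ge> 0" "b \<ge> 0"
      by (auto simp: a_def b_def)
    have "v^2 + w^2 - v * w = 188851/250000 + 154/125 * a + 223/500 * b + (a - b/2)^2 + 3/4 * b^2"
      unfolding a_def b_def by algebra
    moreover have "0 \<le> (a - b/2)^2 + 3/4 * b^2"
      by simp
    ultimately show False
      using that(1) ab by linarith
  qed
  have upper: "t \<le> 97/100" "u \<le> 97/100"
    using le[of t u] le[of u t] g_le bounds by (auto simp: g_def algebra_simps)
  have "kpoly (- t) + kpoly (- u) \<le>
      (32/25 - 681/125 * t + 908/125 * t^3) + (32/25 - 681/125 * u + 908/125 * u^3)"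
    using upper bounds by (intro add_mono kpoly_neg_le_cubic) auto
  also have "\<dots> = 64/25 - 681/125 * (t + u) + 908/125 * ((t + u) * g)"
    unfolding g_def by algebra
  \<comment> \<open>The coefficients 681 and 908 are in the ratio 3 : 4, so with g at its bound 3/4
    the terms in \<open>t + u\<close> cancel.\<close>
  also have "\<dots> \<le> 64/25 - 681/125 * (t + u) + 908/125 * ((t + u) * (3/4))"
    using g_le bounds by (intro add_left_mono mult_left_mono) auto
  also have "\<dots> = 64/25"
    by algebra
  finally show ?thesis
    by (simp add: t_def u_def)
qed

lemma kpoly_triple:
  fixes e x y z :: "'a::real_inner"
  assumes "norm e = 1" "norm x = 1" "norm y = 1" "norm z = 1"
    and xy: "x \<bullet> y \<le> 1/2" and xz: "x \<bullet> z \<le> 1/2" and yz: "y \<bullet> z \<le> 1/2"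
    and t: "e \<bullet> x \<ge> 177/250" and u: "e \<bullet> y \<ge> 177/250" and v: "e \<bullet> z \<ge> 177/250"
  shows "kpoly (- (e \<bullet> x)) + kpoly (- (e \<bullet> y)) + kpoly (- (e \<bullet> z)) \<le> 64/25"
proof -
  define t u v where "t = e \<bullet> x" and "u = e \<bullet> y" and "v = e \<bullet> z"
  define S where "S = t + u + v"
  define Q where "Q = t^2 + u^2 + v^2"
  have bounds: "t \<ge> 177/250" "u \<ge> 177/250" "v \<ge> 177/250"
    using assms by (auto simp: t_def u_def v_def)
  have weighted: "(a * t + b * u + c * v)\<^sup>2 \<le> a^2 + b^2 + c^2 + a * b + a * c + b * c"
    if "a \<ge> 0" "b \<ge> 0" "c \<ge> 0" for a b c
  proof -
    have "(a * t + b * u + c * v)\<^sup>2 = (e \<bullet> (a *\<^sub>R x + b *\<^sub>R y + c *\<^sub>R z))\<^sup>2"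
      by (simp add: t_def u_def v_def inner_add_right)
    also have "\<dots> \<le> (a *\<^sub>R x + b *\<^sub>R y + c *\<^sub>R z) \<bullet> (a *\<^sub>R x + b *\<^sub>R y + c *\<^sub>R z)"
      using assms(1) by (rule inner_unit_square_le)
    also have "\<dots> = a^2 + b^2 + c^2 + 2 * (a * b) * (x \<bullet> y) + 2 * (a * c) * (x \<bullet> z) + 2 * (b * c) * (y \<bullet> z)"
      using assms(2-4) by (simp add: norm_eq_1 inner_add_left inner_add_right inner_commute power2_eq_square algebra_simps)
    also have "\<dots> \<le> a^2 + b^2 + c^2 + 2 * (a * b) * (1/2) + 2 * (a * c) * (1/2) + 2 * (b * c) * (1/2)"
      using that xy xz yz by (intro add_mono mult_left_mono order_refl) auto
    finally show ?thesis
      by simp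
  qed
  \<comment> \<open>Equal weights give S^2 at most 6; the constant is sqrt 6 rounded up.\<close>
  have S_le: "S \<le> 24495/10000"
  proof (rule power2_le_imp_le)
    show "S\<^sup>2 \<le> (24495/10000)\<^sup>2"
      using weighted[of 1 1 1] by (simp add: S_def power2_eq_square)
  qed simp
  have S_ge: "S \<ge> 531/250"
    using bounds by (simp add: S_def)
  have Q_le: "Q \<le> 1/2 + S\<^sup>2 / 4"
  proof -
    \<comment> \<open>The weights solve the linear system whose matrix is the extremal Gram matrix of \<open>x\<close>, \<open>y\<close>, \<open>z\<close>.\<close>
    define h where "h = 2 * Q - S\<^sup>2 / 2"
    have "h = (2 * t - S / 2) * t + (2 * u - S / 2) * u + (2 * v - S / 2) * v"
      unfolding h_def Q_def S_def by algebra
    then have "h\<^sup>2 \<le> (2 * t - S/2)^2 + (2 * u - S/2)^2 + (2 * v - S/2)^2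
        + (2 * t - S/2) * (2 * u - S/2) + (2 * t - S/2) * (2 * v - S/2) + (2 * u - S/2) * (2 * v - S/2)"
      using weighted[of "2 * t - S/2" "2 * u - S/2" "2 * v - S/2"] bounds S_le by simp
    also have "\<dots> = h"
      unfolding h_def Q_def S_def by algebra
    finally have "h * h \<le> 1 * h"
      by (simp add: power2_eq_square)
    then have "h \<le> 1"
      using mult_le_cancel_right_pos[of h h 1] by (cases "h > 0") auto
    then show ?thesis
      by (simp add: h_def)
  qed
  \<comment> \<open>At the corner (19/20, 177/250, 177/250) the difference of the two quadratic
    terms is 505539/1000000 > 1/2, and it only grows beyond.\<close>
  have le: "p \<le> 19/20" if "p^2 + q^2 + r^2 \<le> 1/2 + (p + q + r)\<^sup>2 / 4" "q \<ge> 177/250" "r \<ge> 177/250" for p q r :: real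
  proof (rule ccontr)
    define a b c where "a = p - 19/20" and "b = q - 177/250" and "c = r - 177/250"
    assume "\<not> p \<le> 19/20"
    with that have abc: "a \<ge> 0" "b \<ge> 0" "c \<ge> 0"
      by (auto simp: a_def b_def c_def)
    have "p^2 + q^2 + r^2 - (p + q + r)\<^sup>2 / 4 =
      505539/1000000 + 717/1000 * a + 233/1000 * b + 233/1000 * c
        + ((a - b)^2 + (a - c)^2 + (b - c)^2 + a^2 + b^2 + c^2) / 4"
      unfolding a_def b_def c_def by algebra
    moreover have "0 \<le> ((a - b)^2 + (a - c)^2 + (b - c)^2 + a^2 + b^2 + c^2) / 4"
      by simp
    ultimately show False
      using that(1) abc by linarith
  qed
  have upper: "t \<le> 19/20" "u \<le> 19/20" "v \<le> 19/20"
    using le[of t u v] le[of u t v] le[of v t u] Q_le bounds by (auto simp: Q_def S_def add_ac)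
  have "kpoly (- t) + kpoly (- u) + kpoly (- v) \<le> (3083/500 - 114/5 * t + 3991/200 * t^2)
      + (3083/500 - 114/5 * u + 3991/200 * u^2) + (3083/500 - 114/5 * v + 3991/200 * v^2)"
    using upper bounds by (intro add_mono kpoly_neg_le_quadratic) auto
  also have "\<dots> = 9249/500 - 114/5 * S + 3991/200 * Q"
    unfolding S_def Q_def by algebra
  also have "\<dots> \<le> 9249/500 - 114/5 * S + 3991/200 * (1/2 + S\<^sup>2 / 4)"
    using Q_le by simp
  also have "\<dots> \<le> 64/25"
  proof -
    \<comment> \<open>On the range of \<open>S\<close> its square lies below the chord, which
      reduces the claim to a linear inequality.\<close>
    have "0 \<le> (S - 531/250) * (24495/10000 - S)"
      using S_le S_ge by simp
    also have "\<dots> = 9147/2000 * S - 2601369/500000 - S\<^sup>2"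
      by algebra
    finally have "S\<^sup>2 \<le> 9147/2000 * S - 2601369/500000"
      by simp
    then show ?thesis
      using S_le S_ge by (simp add: field_simps)
  qed
  finally show ?thesis
    by (simp add: t_def u_def v_def)
qed

text \<open>Two of \<open>y 1\<close>, \<open>y 2\<close>, \<open>y 3\<close> lie on the same closed
  side of the line through \<open>y 0\<close>, which the sign of the triple product \<open>s\<close>
  detects. If both make obtuse angles with \<open>y 0\<close>, they cannot also make an obtuse angle
  with each other.\<close>

lemma no_four_negative_in_plane:
  fixes e :: "real^3" and y :: "nat \<Rightarrow> real^3"
  assumes e: "e \<noteq> 0" and perp: "\<And>i. i < 4 \<Longrightarrow> e \<bullet> y i = 0"
  shows "\<exists>i<4. \<exists>j<4. i \<noteq> j \<and> y i \<bullet> y j \<ge> 0"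
proof (rule ccontr)
  assume "\<not> ?thesis"
  then have neg: "y i \<bullet> y j < 0" if "i < 4" "j < 4" "i \<noteq> j" for i j
    using that by force
  define s where "s i = cross3 e (y 0) \<bullet> y i" for i
  have same: False if "s i * s j \<ge> 0" "i < 4" "j < 4" "0 < i" "0 < j" "i \<noteq> j" for i j
  proof -
    have "s i * s j = (e \<bullet> e) * ((y 0 \<bullet> y 0) * (y i \<bullet> y j) - (y 0 \<bullet> y j) * (y i \<bullet> y 0))"
      if "e \<bullet> y 0 = 0" "e \<bullet> y i = 0" "e \<bullet> y j = 0"
    proof -
      \<comment> \<open>A product of two triple products is the determinant of the mixed Gram
        matrix, here expanded along the row of \<open>e\<close>.\<close>
      have "s i * s j = (e \<bullet> e) * ((y 0 \<bullet> y 0) * (y i \<bullet> y j) - (y 0 \<bullet> y j) * (y i \<bullet> y 0))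
        - (e \<bullet> y 0) * ((e \<bullet> y 0) * (y i \<bullet> y j) - (y 0 \<bullet> y j) * (y i \<bullet> e))
        + (e \<bullet> y j) * ((e \<bullet> y 0) * (y i \<bullet> y 0) - (y 0 \<bullet> y 0) * (y i \<bullet> e))"
        unfolding s_def cross3_def inner_vec_def sum_3 inner_real_def by simp algebra
      with that show ?thesis
        by (simp add: inner_commute)
    qed
    then have "s i * s j = (e \<bullet> e) * ((y 0 \<bullet> y 0) * (y i \<bullet> y j) - (y 0 \<bullet> y j) * (y i \<bullet> y 0))"
      using perp that by auto
    moreover have "(y 0 \<bullet> y 0) * (y i \<bullet> y j) \<le> 0"
      using neg[of i j] that by (simp add: mult_nonneg_nonpos)
    moreover have "(y 0 \<bullet> y j) * (y i \<bullet> y 0) > 0"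
      using neg[of 0 j] neg[of i 0] that by (simp add: mult_neg_neg)
    moreover have "e \<bullet> e > 0"
      using e by simp
    ultimately show False
      using that(1) by (smt (verit) mult_pos_neg)
  qed
  have "s 1 * s 2 \<ge> 0 \<or> s 1 * s 3 \<ge> 0 \<or> s 2 * s 3 \<ge> 0"
    by (metis linorder_le_cases mult_nonneg_nonneg mult_nonpos_nonpos)
  with same[of 1 2] same[of 1 3] same[of 2 3] show False
    by auto
qed

text \<open>After projection to the plane orthogonal to \<open>e\<close>, any two of the points have
  inner product at most 1/2 - (177/250)^2 < 0. This is where the threshold has to exceed 1/sqrt
  2.\<close>

lemma card_le_3_if_far:
  fixes Y :: "(real^3) set"
  assumes "finite Y" "norm e = 1"
    and sep: "\<And>x y. x \<in> Y \<Longrightarrow> y \<in> Y \<Longrightarrow> x \<noteq> y \<Longrightarrow> x \<bullet> y \<le> 1/2"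
    and far: "\<And>y. y \<in> Y \<Longrightarrow> e \<bullet> y \<ge> 177/250"
  shows "card Y \<le> 3"
proof (rule ccontr)
  assume "\<not> card Y \<le> 3"
  then obtain f where f: "inj_on f {..<4::nat}" "f ` {..<4} \<subseteq> Y"
    using card_le_inj[of "{..<4::nat}" Y] \<open>finite Y\<close> by auto
  define g where "g i = f i - (e \<bullet> f i) *\<^sub>R e" for i
  have "e \<bullet> g i = 0" for i
    using assms(2) by (simp add: g_def inner_diff_right norm_eq_1)
  then obtain i j where ij: "i < 4" "j < 4" "i \<noteq> j" "g i \<bullet> g j \<ge> 0"
    using no_four_negative_in_plane[of e g] assms(2) by force
  have fij: "f i \<in> Y" "f j \<in> Y" "f i \<noteq> f j"
    using f ij by (auto dest: inj_onD)
  have "g i \<bullet> g j = f i \<bullet> f j - (e \<bullet> f i) * (e \<bullet> f j)"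
    using assms(2) by (simp add: g_def inner_diff_left inner_diff_right norm_eq_1 inner_commute algebra_simps)
  also have "\<dots> \<le> 1/2 - 177/250 * (177/250)"
    using sep[of "f i" "f j"] far[of "f i"] far[of "f j"] fij by (intro diff_mono mult_mono) auto
  also have "\<dots> < 0"
    by simp
  finally show False
    using ij by simp
qed

text \<open>The same constant serves for every possible number of points; \<open>e\<close> will be
  the antipode of the point whose row is summed.\<close>

lemma sum_kpoly_far_le:
  fixes Y :: "(real^3) set"
  assumes "finite Y" "norm e = 1" "Y \<subseteq> sphere 0 1"
    and sep: "\<And>x y. x \<in> Y \<Longrightarrow> y \<in> Y \<Longrightarrow> x \<noteq> y \<Longrightarrow> x \<bullet> y \<le> 1/2"
    and far: "\<And>y. y \<in> Y \<Longrightarrow> e \<bullet> y \<ge> 177/250"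
  shows "(\<Sum>y\<in>Y. kpoly (- (e \<bullet> y))) \<le> 64/25"
proof -
  have "card Y \<le> 3"
    using card_le_3_if_far assms by blast
  have n: "norm y = 1" if "y \<in> Y" for y
    using assms(3) that by auto
  consider "card Y = 0" | "card Y = 1" | "card Y = 2" | "card Y = 3"
    using \<open>card Y \<le> 3\<close> by linarith
  then show ?thesis
  proof cases
    case 1
    then show ?thesis
      using \<open>finite Y\<close> by simp
  next
    case 2
    then obtain y where y: "Y = {y}"
      by (rule card_1_singletonE)
    have "e \<bullet> y \<le> 1"
      using norm_cauchy_schwarz[of e y] n[of y] assms(2) by (simp add: y)
    then show ?thesis
      using kpoly_neg_le[of "e \<bullet> y"] far[of y] by (simp add: y)
  next
    case 3
    then obtain x y where Y: "Y = {x, y}" "x \<noteq> y"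
      by (auto simp: card_2_iff)
    then show ?thesis
      using kpoly_pair[of e x y] assms n by simp
  next
    case 4
    then obtain x y z where Y: "Y = {x, y, z}" "x \<noteq> y" "y \<noteq> z" "x \<noteq> z"
      by (auto simp: card_3_iff)
    then show ?thesis
      using kpoly_triple[of e x y z] assms n by (simp add: add.assoc)
  qed
qed

lemma psd_on_kpoly:
  fixes X :: "(real^3) set"
  assumes "X \<subseteq> sphere 0 1"
  shows "psd_on X (\<lambda>x y. kpoly (x \<bullet> y) - 1)"
proof -
  \<comment> \<open>The kernel of degree 1: its double sum is the squared norm of the sum of all
    points. The constant term of \<open>kpoly\<close> is the 1 subtracted in the claim.\<close>
  have "psd_on X (\<lambda>x y. x \<bullet> y)"
    by (simp add: psd_on_def flip: inner_sum_left inner_sum_right)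
  note kernels = psd_on_add[OF psd_on_add[OF psd_on_add[OF psd_on_add[OF
      psd_on_scale[OF _ this, of "71/40"]
      psd_on_scale[OF _ psd_on_legendre2[OF assms], of "1753/500"]]
      psd_on_scale[OF _ psd_on_legendre3[OF assms], of "1737/1000"]]
      psd_on_scale[OF _ psd_on_legendre4[OF assms], of "249/125"]]
      psd_on_scale[OF _ psd_on_legendre9[OF assms], of "107/250"]]
  show ?thesis
    by (rule psd_on_cong[OF kernels]; (unfold kpoly_def, algebra)?; simp)
qed

theorem kissing_number_3:
  fixes X :: "(real^3) set"
  assumes "finite X" "X \<subseteq> sphere 0 1"
    and sep: "\<And>x y. x \<in> X \<Longrightarrow> y \<in> X \<Longrightarrow> x \<noteq> y \<Longrightarrow> x \<bullet> y \<le> 1/2"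
  shows "card X \<le> 12"
proof -
  have n: "norm y = 1" if "y \<in> X" for y
    using assms(2) that by auto
  \<comment> \<open>The diagonal contributes \<open>kpoly 1\<close> = 5219/500 and the antipodal
    points at most 64/25; together this is 12.998.\<close>
  have row: "(\<Sum>y\<in>X. kpoly (x \<bullet> y)) \<le> 6499/500" if x: "x \<in> X" for x
  proof -
    define Y where "Y = {y \<in> X. x \<bullet> y \<le> - (177/250)}"
    have xx: "x \<bullet> x = 1"
      using n[OF x] by (simp add: norm_eq_1)
    have Y: "Y \<subseteq> X - {x}"
      using xx by (auto simp: Y_def)
    have "(\<Sum>y\<in>X. kpoly (x \<bullet> y)) = kpoly (x \<bullet> x) + (\<Sum>y\<in>X - {x}. kpoly (x \<bullet> y))"
      using x \<open>finite X\<close> by (simp add: sum.remove)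
    also have "(\<Sum>y\<in>X - {x}. kpoly (x \<bullet> y)) = (\<Sum>y\<in>X - {x} - Y. kpoly (x \<bullet> y)) + (\<Sum>y\<in>Y. kpoly (x \<bullet> y))"
      using Y \<open>finite X\<close> by (intro sum.subset_diff) auto
    also have "(\<Sum>y\<in>X - {x} - Y. kpoly (x \<bullet> y)) \<le> 0"
      using sep[OF x] by (intro sum_nonpos kpoly_nonpos) (auto simp: Y_def)
    also have "(\<Sum>y\<in>Y. kpoly (x \<bullet> y)) = (\<Sum>y\<in>Y. kpoly (- ((- x) \<bullet> y)))"
      by simp
    also have "\<dots> \<le> 64/25"
      using n[OF x] assms by (intro sum_kpoly_far_le) (auto simp: Y_def)
    also have "kpoly (x \<bullet> x) = 5219/500"
      by (simp add: xx kpoly_def)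
    finally show ?thesis
      by simp
  qed
  have "0 \<le> (\<Sum>x\<in>X. \<Sum>y\<in>X. kpoly (x \<bullet> y) - 1)"
    using psd_on_kpoly[OF assms(2)] by (simp add: psd_on_def)
  also have "\<dots> = (\<Sum>x\<in>X. \<Sum>y\<in>X. kpoly (x \<bullet> y)) - real (card X) * real (card X)"
    by (simp add: sum_subtractf)
  finally have "real (card X) * real (card X) \<le> (\<Sum>x\<in>X. \<Sum>y\<in>X. kpoly (x \<bullet> y))"
    by simp
  also have "\<dots> \<le> (\<Sum>x\<in>X. 6499/500)"
    by (intro sum_mono row)
  finally have "real (card X) * real (card X) \<le> 6499/500 * real (card X)"
    by simp
  then have "real (card X) \<le> 6499/500"
    by (cases "card X = 0") auto
  then show ?thesis
    by simp
qed

subsection \<open>The Prekopa-Leindler and Brunn-Minkowski inequalities\<close>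

lemma lmeasurable_bounded_borel: "A \<in> sets borel \<Longrightarrow> bounded A \<Longrightarrow> A \<in> lmeasurable"
  for A :: "'a::euclidean_space set"
  by (auto intro!: bounded_set_imp_lmeasurable)

lemma borel_affine_image:
  fixes A :: "'a::euclidean_space set"
  assumes "A \<in> sets borel" "c \<noteq> 0"
  shows "(\<lambda>x. c *\<^sub>R x + t) ` A \<in> sets borel"
proof -
  have "(\<lambda>x. c *\<^sub>R x + t) ` A = (\<lambda>y. (1 / c) *\<^sub>R (y - t)) -` A \<inter> space borel"
    using assms(2) by (force simp: image_iff)
  also have "\<dots> \<in> sets borel"
    by (rule measurable_sets[OF _ assms(1)]) measurable
  finally show ?thesis .
qed

lemma lmeasurable_affine_image:
  fixes A :: "'a::euclidean_space set"
  assumes "A \<in> sets borel" "bounded A" "c \<noteq> 0"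
  shows "(\<lambda>x. c *\<^sub>R x + t) ` A \<in> lmeasurable"
proof (rule lmeasurable_bounded_borel)
  show "bounded ((\<lambda>x. c *\<^sub>R x + t) ` A)"
    using bounded_translation[OF bounded_scaling[OF assms(2), of c], of t]
    by (simp add: image_image add.commute)
qed (use assms in \<open>auto intro: borel_affine_image\<close>)

text \<open>Cut \<open>A\<close> at a point \<open>a\<close> near its supremum and \<open>B\<close>
  at a point \<open>b\<close> near its infimum. The translates (1 - l) A1 + l b and l B1 + (1 - l) a
  both lie in \<open>C\<close> and meet in at most one point, so their lengths add; each cut costs
  at most \<open>e\<close>.\<close>

lemma brunn_minkowski_real:
  fixes A B C :: "real set"
  assumes A: "A \<in> sets borel" "bounded A" "A \<noteq> {}"
    and B: "B \<in> sets borel" "bounded B" "B \<noteq> {}"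
    and C: "C \<in> sets borel" "bounded C"
    and l: "0 < l" "l < 1"
    and sub: "\<And>a b. a \<in> A \<Longrightarrow> b \<in> B \<Longrightarrow> (1 - l) * a + l * b \<in> C"
  shows "(1 - l) * measure lebesgue A + l * measure lebesgue B \<le> measure lebesgue C"
proof (rule field_le_epsilon)
  fix e :: real
  assume "e > 0"
  have bdd: "bdd_above A" "bdd_below B"
    using A B by (auto intro: bounded_imp_bdd_above bounded_imp_bdd_below)
  obtain a where a: "a \<in> A" "Sup A - e < a"
    using less_cSupE[of "Sup A - e" A] A \<open>e > 0\<close> by force
  obtain b where b: "b \<in> B" "b < Inf B + e"
    using cInf_lessD[of B "Inf B + e"] B \<open>e > 0\<close> by force
  define A1 where "A1 = A \<inter> {..a}"
  define B1 where "B1 = B \<inter> {b..}"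
  have lm [simp]: "A \<in> lmeasurable" "B \<in> lmeasurable" "C \<in> lmeasurable" "A1 \<in> lmeasurable" "B1 \<in> lmeasurable"
    using A B C by (auto intro!: lmeasurable_bounded_borel simp: A1_def B1_def intro: bounded_subset)
  have mA: "measure lebesgue A \<le> measure lebesgue A1 + e"
  proof -
    have "A \<subseteq> A1 \<union> {a..Sup A}"
      using cSup_upper[OF _ bdd(1)] by (auto simp: A1_def)
    then have "measure lebesgue A \<le> measure lebesgue (A1 \<union> {a..Sup A})"
      by (intro measure_mono_fmeasurable) (auto intro: fmeasurableD)
    also have "\<dots> \<le> measure lebesgue A1 + measure lebesgue {a..Sup A}"
      by (intro measure_Un_le) (auto intro: fmeasurableD)
    also have "measure lebesgue {a..Sup A} \<le> e"
      using a \<open>e > 0\<close> by (cases "a \<le> Sup A") auto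
    finally show ?thesis by simp
  qed
  have mB: "measure lebesgue B \<le> measure lebesgue B1 + e"
  proof -
    have "B \<subseteq> B1 \<union> {Inf B..b}"
      using cInf_lower[OF _ bdd(2)] by (auto simp: B1_def)
    then have "measure lebesgue B \<le> measure lebesgue (B1 \<union> {Inf B..b})"
      by (intro measure_mono_fmeasurable) (auto intro: fmeasurableD)
    also have "\<dots> \<le> measure lebesgue B1 + measure lebesgue {Inf B..b}"
      by (intro measure_Un_le) (auto intro: fmeasurableD)
    also have "measure lebesgue {Inf B..b} \<le> e"
      using b \<open>e > 0\<close> by (cases "Inf B \<le> b") auto
    finally show ?thesis by simp
  qed
  define A2 where "A2 = (\<lambda>x. (1 - l) *\<^sub>R x + l * b) ` A1"
  define B2 where "B2 = (\<lambda>x. l *\<^sub>R x + (1 - l) * a) ` B1"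
  have m2: "measure lebesgue A2 = (1 - l) * measure lebesgue A1" "measure lebesgue B2 = l * measure lebesgue B1"
    using l by (simp_all add: A2_def B2_def measure_lebesgue_affine del: real_scaleR_def)
  have "A1 \<in> sets borel" "bounded A1" "B1 \<in> sets borel" "bounded B1"
    using A B by (auto simp: A1_def B1_def intro: bounded_subset)
  then have A2: "A2 \<in> lmeasurable" and B2: "B2 \<in> lmeasurable"
    unfolding A2_def B2_def using l by (simp_all only: lmeasurable_affine_image less_imp_neq diff_gt_0_iff_gt less_imp_neq[symmetric] simp_thms right_minus_eq)
  have "A2 \<inter> B2 \<subseteq> {(1 - l) * a + l * b}"
  proof
    fix z assume "z \<in> A2 \<inter> B2"
    then have "z \<in> A2" "z \<in> B2"
      by auto
    obtain x where x: "x \<le> a" "z = (1 - l) * x + l * b"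
      using \<open>z \<in> A2\<close> by (auto simp: A2_def A1_def)
    obtain y where y: "b \<le> y" "z = l * y + (1 - l) * a"
      using \<open>z \<in> B2\<close> by (auto simp: B2_def B1_def)
    have "z \<le> (1 - l) * a + l * b" "z \<ge> (1 - l) * a + l * b"
      using mult_left_mono[OF x(1), of "1 - l"] mult_left_mono[OF y(1), of l] x(2) y(2) l by linarith+
    then show "z \<in> {(1 - l) * a + l * b}" by auto
  qed
  then have "negligible (A2 \<inter> B2)"
    using negligible_subset negligible_sing by blast
  then have "measure lebesgue A2 + measure lebesgue B2 = measure lebesgue (A2 \<union> B2)"
    using A2 B2 by (simp add: measure_Un3 negligible_imp_measure0)
  also have "\<dots> \<le> measure lebesgue C"
    using A2 B2 sub a b
    by (intro measure_mono_fmeasurable) (auto simp: A2_def B2_def A1_def B1_def add.commute)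
  finally have "(1 - l) * measure lebesgue A1 + l * measure lebesgue B1 \<le> measure lebesgue C"
    by (simp add: m2)
  moreover have "(1 - l) * measure lebesgue A + l * measure lebesgue B
      \<le> (1 - l) * (measure lebesgue A1 + e) + l * (measure lebesgue B1 + e)"
    using mA mB l by (intro add_mono mult_left_mono) auto
  ultimately show "(1 - l) * measure lebesgue A + l * measure lebesgue B \<le> measure lebesgue C + e"
    by (simp add: algebra_simps)
qed

text \<open>Bounded nonnegative Borel functions of bounded support: integrable, and stable under
  slicing and partial integration, as the induction on dimension requires.\<close>

definition nice_fun :: "('a::euclidean_space \<Rightarrow> real) \<Rightarrow> bool" where
  "nice_fun f \<longleftrightarrow> f \<in> borel_measurable borel \<and>
     (\<exists>M R. \<forall>x. 0 \<le> f x \<and> f x \<le> M \<and> (norm x > R \<longrightarrow> f x = 0))"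

lemma nice_funE:
  assumes "nice_fun f"
  obtains M R where "f \<in> borel_measurable borel" "M > 0" "R > 0" "\<And>x. 0 \<le> f x" "\<And>x. f x \<le> M"
    "\<And>x. norm x > R \<Longrightarrow> f x = 0"
proof -
  from assms obtain M R where "f \<in> borel_measurable borel" "\<And>x. 0 \<le> f x \<and> f x \<le> M \<and> (norm x > R \<longrightarrow> f x = 0)"
    by (auto simp: nice_fun_def)
  then show ?thesis
    by (intro that[of "max M 1" "max R 1"]) (auto simp: less_max_iff_disj le_max_iff_disj)
qed

lemma nice_fun_nonneg: "nice_fun f \<Longrightarrow> 0 \<le> f x"
  by (auto simp: nice_fun_def)

lemma nice_fun_measurable: "nice_fun f \<Longrightarrow> f \<in> borel_measurable borel"
  by (auto simp: nice_fun_def)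

lemma nice_fun_integrable:
  assumes "nice_fun f"
  shows "integrable lborel f"
proof -
  obtain M R where MR: "f \<in> borel_measurable borel" "M > 0" "R > 0" "\<And>x. 0 \<le> f x" "\<And>x. f x \<le> M"
    "\<And>x. norm x > R \<Longrightarrow> f x = 0"
    using nice_funE[OF assms] by metis
  show ?thesis
  proof (rule integrableI_bounded_set[where A = "cball 0 R" and B = M])
    show "emeasure lborel (cball (0::'a) R) < \<infinity>"
      using emeasure_lborel_cball_finite by (simp add: top.not_eq_extremum)
    show "AE x in lborel. x \<notin> cball 0 R \<longrightarrow> f x = 0"
      using MR by (simp add: not_le)
  qed (use MR in auto)
qed

text \<open>Tonelli's theorem for the region under the graph.\<close>

lemma layer_cake:
  fixes f :: "'a::euclidean_space \<Rightarrow> real"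
  assumes [measurable]: "f \<in> borel_measurable borel" and nonneg: "\<And>x. 0 \<le> f x"
  shows "(\<integral>\<^sup>+x. ennreal (f x) \<partial>lborel) =
    (\<integral>\<^sup>+t. indicator {0..} t * emeasure lborel {x. f x > t} \<partial>lborel)"
proof -
  have "(\<integral>\<^sup>+x. ennreal (f x) \<partial>lborel) = (\<integral>\<^sup>+x. (\<integral>\<^sup>+t. indicator {0..<f x} t \<partial>lborel) \<partial>lborel)"
    using nonneg by simp
  also have "\<dots> = (\<integral>\<^sup>+x. (\<integral>\<^sup>+t. indicator {p. 0 \<le> snd p \<and> snd p < f (fst p)} (x, t) \<partial>lborel) \<partial>lborel)"
    by (intro nn_integral_cong) (auto simp: indicator_def)
  also have "\<dots> = (\<integral>\<^sup>+t. (\<integral>\<^sup>+x. indicator {p. 0 \<le> snd p \<and> snd p < f (fst p)} (x, t) \<partial>lborel) \<partial>lborel)"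
    by (rule lborel_pair.Fubini'[symmetric]) measurable
  also have "\<dots> = (\<integral>\<^sup>+t. (\<integral>\<^sup>+x. indicator {0..} t * indicator {x. f x > t} x \<partial>lborel) \<partial>lborel)"
    by (intro nn_integral_cong) (auto simp: indicator_def)
  also have "\<dots> = (\<integral>\<^sup>+t. indicator {0..} t * emeasure lborel {x. f x > t} \<partial>lborel)"
    by (intro nn_integral_cong) (simp add: nn_integral_cmult)
  finally show ?thesis .
qed

text \<open>With both suprema equal to 1, the level sets of \<open>f\<close> and \<open>g\<close> at
  the same height \<open>t\<close> are nonempty for t < 1 and empty from 1 on. Their weighted sum
  lies in the level set of \<open>h\<close>, so the inequality for lengths can be integrated over
  \<open>t\<close>.\<close>

lemma prekopa_leindler_real_normalized:
  fixes f g h :: "real \<Rightarrow> real"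
  assumes nice: "nice_fun f" "nice_fun g" "nice_fun h" and l: "0 < l" "l < 1"
    and f1: "\<And>x. f x \<le> 1" "\<And>t. t < 1 \<Longrightarrow> \<exists>x. f x > t"
    and g1: "\<And>x. g x \<le> 1" "\<And>t. t < 1 \<Longrightarrow> \<exists>x. g x > t"
    and h: "\<And>x y. f x powr (1 - l) * g y powr l \<le> h ((1 - l) * x + l * y)"
  shows "(1 - l) * (\<integral>x. f x \<partial>lborel) + l * (\<integral>x. g x \<partial>lborel) \<le> (\<integral>x. h x \<partial>lborel)"
proof -
  note [measurable] = nice[THEN nice_fun_measurable]
  have level: "{x. k x > t} \<in> sets borel" "bounded {x. k x > t}"
    if k: "nice_fun k" "t \<ge> 0" for k and t :: real
  proof -
    note [measurable] = nice_fun_measurable[OF k(1)]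
    show "{x. k x > t} \<in> sets borel"
      by measurable
    obtain R where "\<And>x. norm x > R \<Longrightarrow> k x = 0"
      using nice_funE[OF k(1)] by metis
    then have "{x. k x > t} \<subseteq> cball 0 R"
      using k(2) by (force simp: not_less[symmetric])
    then show "bounded {x. k x > t}"
      using bounded_cball bounded_subset by blast
  qed
  have em: "emeasure lborel {x. k x > t} = ennreal (measure lebesgue {x. k x > t})"
    if "nice_fun k" "t \<ge> 0" for k and t :: real
    using level[OF that] emeasure_bounded_finite[OF level(2)[OF that]]
    by (simp add: emeasure_eq_ennreal_measure)
  have ineq: "indicator {0..} t * (ennreal (1 - l) * emeasure lborel {x. f x > t} + ennreal l * emeasure lborel {x. g x > t})
      \<le> indicator {0..} t * emeasure lborel {x. h x > t}" for t :: real
  proof (cases "0 \<le> t \<and> t < 1")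
    case True
    have "(1 - l) * measure lebesgue {x. f x > t} + l * measure lebesgue {x. g x > t} \<le> measure lebesgue {x. h x > t}"
    proof (rule brunn_minkowski_real)
      fix a b assume ab: "a \<in> {x. f x > t}" "b \<in> {x. g x > t}"
      have "t = t powr (1 - l) * t powr l"
        using True by (cases "t = 0") (simp_all flip: powr_add)
      also have "\<dots> < f a powr (1 - l) * g b powr l"
        using ab True l by (intro mult_strict_mono' powr_less_mono2) auto
      also have "\<dots> \<le> h ((1 - l) * a + l * b)"
        by (rule h)
      finally show "(1 - l) * a + l * b \<in> {x. h x > t}"
        by simp
    qed (use True nice level f1 g1 l in auto)
    then have "ennreal (1 - l) * emeasure lborel {x. f x > t} + ennreal l * emeasure lborel {x. g x > t} \<le> emeasure lborel {x. h x > t}"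
      using True nice l by (simp add: em flip: ennreal_mult ennreal_plus)
    then show ?thesis
      using True by simp
  next
    case False
    then have "t \<ge> 0 \<Longrightarrow> {x. f x > t} = {} \<and> {x. g x > t} = {}"
      using f1(1) g1(1) by (auto simp: not_less intro: order_trans)
    then show ?thesis
      by (cases "t \<ge> 0") auto
  qed
  have [measurable]: "(\<lambda>t. emeasure lborel {x. k x > t}) \<in> borel_measurable borel" if "nice_fun k" for k :: "real \<Rightarrow> real"
  proof -
    note [measurable] = nice_fun_measurable[OF that]
    show ?thesis by measurable
  qed
  have "ennreal (1 - l) * (\<integral>\<^sup>+x. ennreal (f x) \<partial>lborel) + ennreal l * (\<integral>\<^sup>+x. ennreal (g x) \<partial>lborel)
     = (\<integral>\<^sup>+t. indicator {0..} t * (ennreal (1 - l) * emeasure lborel {x. f x > t} + ennreal l * emeasure lborel {x. g x > t}) \<partial>lborel)"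
    using nice by (simp add: layer_cake nice_fun_nonneg nice_fun_measurable distrib_left mult.left_commute nn_integral_add nn_integral_cmult)
  also have "\<dots> \<le> (\<integral>\<^sup>+t. indicator {0..} t * emeasure lborel {x. h x > t} \<partial>lborel)"
    by (intro nn_integral_mono ineq)
  also have "\<dots> = (\<integral>\<^sup>+x. ennreal (h x) \<partial>lborel)"
    using nice by (simp add: layer_cake nice_fun_nonneg nice_fun_measurable)
  finally have "ennreal ((1 - l) * (\<integral>x. f x \<partial>lborel) + l * (\<integral>x. g x \<partial>lborel)) \<le> ennreal (\<integral>x. h x \<partial>lborel)"
    using nice l by (simp add: nn_integral_eq_integral nice_fun_integrable nice_fun_nonneg ennreal_mult ennreal_plus)
  then show ?thesis
    using nice by (simp add: nice_fun_nonneg)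
qed

lemma nice_fun_scale: "nice_fun f \<Longrightarrow> 0 \<le> c \<Longrightarrow> nice_fun (\<lambda>x. c * f x)"
  unfolding nice_fun_def by (auto intro!: mult_left_mono exI)

text \<open>Divide \<open>f\<close> and \<open>g\<close> by their suprema and \<open>h\<close> by
  the matching weighted geometric mean \<open>P\<close>; the hypothesis is invariant under this. The
  arithmetic mean obtained from the normalized case dominates the geometric mean by Young's
  inequality.\<close>

lemma prekopa_leindler_real:
  fixes f g h :: "real \<Rightarrow> real"
  assumes nice: "nice_fun f" "nice_fun g" "nice_fun h" and l: "0 < l" "l < 1"
    and h: "\<And>x y. f x powr (1 - l) * g y powr l \<le> h ((1 - l) *\<^sub>R x + l *\<^sub>R y)"
  shows "(\<integral>x. f x \<partial>lborel) powr (1 - l) * (\<integral>x. g x \<partial>lborel) powr l \<le> (\<integral>x. h x \<partial>lborel)"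
proof (cases "(\<forall>x. f x = 0) \<or> (\<forall>x. g x = 0)")
  case True
  then have "(\<integral>x. f x \<partial>lborel) = 0 \<or> (\<integral>x. g x \<partial>lborel) = 0"
    by auto
  moreover have "0 \<le> (\<integral>x. h x \<partial>lborel)"
    using nice by (simp add: nice_fun_nonneg)
  ultimately show ?thesis
    by auto
next
  case False
  have sup: "\<exists>M>0. (\<forall>x. k x \<le> M) \<and> (\<forall>t<M. \<exists>x. k x > t)" if k: "nice_fun k" "\<exists>x. k x \<noteq> 0" for k :: "real \<Rightarrow> real"
  proof -
    obtain M where "\<And>x. k x \<le> M"
      using nice_funE[OF k(1)] by metis
    then have bdd: "bdd_above (range k)"
      by (intro bdd_aboveI[of _ M]) auto
    obtain x where "k x > 0"
      using k nice_fun_nonneg[OF k(1)] by (metis less_eq_real_def)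
    then have "0 < (SUP x. k x)"
      using bdd by (meson UNIV_I cSUP_upper less_le_trans)
    then show ?thesis
      using bdd by (intro exI[of _ "SUP x. k x"]) (auto simp: less_cSUP_iff intro: cSUP_upper)
  qed
  obtain M where M: "M > 0" "\<And>x. f x \<le> M" "\<And>t. t < M \<Longrightarrow> \<exists>x. f x > t"
    using sup[OF nice(1)] False by blast
  obtain N where N: "N > 0" "\<And>x. g x \<le> N" "\<And>t. t < N \<Longrightarrow> \<exists>x. g x > t"
    using sup[OF nice(2)] False by blast
  define P where "P = M powr (1 - l) * N powr l"
  have "P > 0"
    using M N by (simp add: P_def)
  have "(1 - l) * (\<integral>x. (1/M) * f x \<partial>lborel) + l * (\<integral>x. (1/N) * g x \<partial>lborel) \<le> (\<integral>x. (1/P) * h x \<partial>lborel)"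
  proof (rule prekopa_leindler_real_normalized[OF _ _ _ l])
    show "nice_fun (\<lambda>x. (1/M) * f x)" "nice_fun (\<lambda>x. (1/N) * g x)" "nice_fun (\<lambda>x. (1/P) * h x)"
      using nice M N \<open>P > 0\<close> by (intro nice_fun_scale; simp)+
    show "(1/M) * f x \<le> 1" "(1/N) * g x \<le> 1" for x
      using M N by (simp_all add: field_simps)
    show "\<exists>x. (1/M) * f x > t" "\<exists>x. (1/N) * g x > t" if "t < 1" for t
      using M(3)[of "t * M"] N(3)[of "t * N"] that M(1) N(1) by (auto simp: field_simps)
    show "((1/M) * f x) powr (1 - l) * ((1/N) * g y) powr l \<le> (1/P) * h ((1 - l) * x + l * y)" for x y
    proof -
      have "((1/M) * f x) powr (1 - l) * ((1/N) * g y) powr l = (1/P) * (f x powr (1 - l) * g y powr l)"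
        using M N nice by (simp add: P_def powr_divide nice_fun_nonneg)
      also have "\<dots> \<le> (1/P) * h ((1 - l) * x + l * y)"
        using h[of x y] \<open>P > 0\<close> by (intro mult_left_mono) auto
      finally show ?thesis .
    qed
  qed
  then have lin: "(1 - l) * ((\<integral>x. f x \<partial>lborel) / M) + l * ((\<integral>x. g x \<partial>lborel) / N) \<le> (\<integral>x. h x \<partial>lborel) / P"
    by simp
  define a where "a = (\<integral>x. f x \<partial>lborel) / M"
  define b where "b = (\<integral>x. g x \<partial>lborel) / N"
  have ab: "a \<ge> 0" "b \<ge> 0"
    using nice M N by (auto simp: a_def b_def nice_fun_nonneg)
  have "a powr (1 - l) * b powr l \<le> (1 - l) * a + l * b"
    using ab l Youngs_inequality_0[of "1 - l" l a b] by (cases "a = 0 \<or> b = 0") auto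
  also have "\<dots> \<le> (\<integral>x. h x \<partial>lborel) / P"
    using lin by (simp add: a_def b_def)
  finally have "P * (a powr (1 - l) * b powr l) \<le> (\<integral>x. h x \<partial>lborel)"
    using \<open>P > 0\<close> by (simp add: pos_le_divide_eq mult.commute)
  moreover have "P * (a powr (1 - l) * b powr l) = (\<integral>x. f x \<partial>lborel) powr (1 - l) * (\<integral>x. g x \<partial>lborel) powr l"
    using M N nice by (simp add: P_def a_def b_def powr_divide nice_fun_nonneg)
  ultimately show ?thesis
    by simp
qed

lemma nice_fun_slice:
  assumes "nice_fun f"
  shows "nice_fun (\<lambda>y. f (x, y))"
proof -
  obtain M R where MR: "f \<in> borel_measurable borel" "M > 0" "R > 0" "\<And>x. 0 \<le> f x" "\<And>x. f x \<le> M"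
    "\<And>x. norm x > R \<Longrightarrow> f x = 0"
    using nice_funE[OF assms] by metis
  have "(\<lambda>y. f (x, y)) \<in> borel_measurable borel"
    using MR(1) by measurable
  moreover have "f (x, y) = 0" if "norm y > R" for y
    using that norm_snd_le[of y x] by (intro MR(6)) simp
  ultimately show ?thesis
    using MR unfolding nice_fun_def by blast
qed

lemma nice_fun_integral_slice:
  fixes f :: "'a::euclidean_space \<times> 'b::euclidean_space \<Rightarrow> real"
  assumes "nice_fun f"
  shows "nice_fun (\<lambda>x. \<integral>y. f (x, y) \<partial>lborel)"
proof -
  obtain M R where MR: "f \<in> borel_measurable borel" "M > 0" "R > 0" "\<And>x. 0 \<le> f x" "\<And>x. f x \<le> M"
    "\<And>x. norm x > R \<Longrightarrow> f x = 0"
    using nice_funE[OF assms] by metis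
  have [measurable]: "f \<in> borel_measurable (borel \<Otimes>\<^sub>M borel)"
    using MR(1) by (simp add: borel_prod)
  have "(\<lambda>x. \<integral>y. f (x, y) \<partial>lborel) \<in> borel_measurable borel"
    by measurable
  moreover have "(\<integral>y. f (x, y) \<partial>lborel) \<le> M * measure lborel (cball (0::'b) R)" for x
  proof -
    have "(\<integral>y. f (x, y) \<partial>lborel) \<le> (\<integral>y. M * indicator (cball (0::'b) R) y \<partial>lborel)"
    proof (rule integral_mono_AE)
      show "integrable lborel (\<lambda>y. f (x, y))"
        using nice_fun_integrable nice_fun_slice assms by blast
      show "integrable lborel (\<lambda>y. M * indicator (cball (0::'b) R) y)"
        using emeasure_lborel_cball_finite by (intro integrable_mult_right integrable_real_indicator) auto
      have "f (x, y) \<le> M * indicator (cball (0::'b) R) y" for y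
        using MR(5)[of "(x, y)"] MR(6)[of "(x, y)"] norm_snd_le[of y x]
        by (cases "norm y \<le> R") (auto simp: indicator_def)
      then show "AE y in lborel. f (x, y) \<le> M * indicator (cball (0::'b) R) y"
        by simp
    qed
    also have "\<dots> = M * measure lborel (cball (0::'b) R)"
      by simp
    finally show ?thesis .
  qed
  moreover have "(\<integral>y. f (x, y) \<partial>lborel) = 0" if "norm x > R" for x
  proof -
    have "f (x, y) = 0" for y
      using that norm_fst_le[of x y] by (intro MR(6)) simp
    then show ?thesis by simp
  qed
  moreover have "0 \<le> (\<integral>y. f (x, y) \<partial>lborel)" for x
    using MR(4) by simp
  ultimately show ?thesis
    unfolding nice_fun_def by blast
qed

lemma integral_nice_fun_prod:
  fixes f :: "'a::euclidean_space \<times> 'b::euclidean_space \<Rightarrow> real"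
  assumes "nice_fun f"
  shows "(\<integral>p. f p \<partial>lborel) = (\<integral>x. (\<integral>y. f (x, y) \<partial>lborel) \<partial>lborel)"
  using lborel_pair.integral_fst'[of f] nice_fun_integrable[OF assms] by (simp add: lborel_prod)

text \<open>Tensorization: the inequality on the second factor shows that the fibre integrals
  satisfy the hypothesis of the inequality on the first.\<close>

lemma prekopa_leindler_prod:
  fixes f g h :: "'a::euclidean_space \<times> 'b::euclidean_space \<Rightarrow> real"
  assumes PLa: "\<And>f g h :: 'a \<Rightarrow> real. nice_fun f \<Longrightarrow> nice_fun g \<Longrightarrow> nice_fun h \<Longrightarrow>
      (\<And>x y. f x powr (1 - l) * g y powr l \<le> h ((1 - l) *\<^sub>R x + l *\<^sub>R y)) \<Longrightarrow>
      (\<integral>x. f x \<partial>lborel) powr (1 - l) * (\<integral>x. g x \<partial>lborel) powr l \<le> (\<integral>x. h x \<partial>lborel)"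
    and PLb: "\<And>f g h :: 'b \<Rightarrow> real. nice_fun f \<Longrightarrow> nice_fun g \<Longrightarrow> nice_fun h \<Longrightarrow>
      (\<And>x y. f x powr (1 - l) * g y powr l \<le> h ((1 - l) *\<^sub>R x + l *\<^sub>R y)) \<Longrightarrow>
      (\<integral>x. f x \<partial>lborel) powr (1 - l) * (\<integral>x. g x \<partial>lborel) powr l \<le> (\<integral>x. h x \<partial>lborel)"
    and nice: "nice_fun f" "nice_fun g" "nice_fun h"
    and h: "\<And>x y. f x powr (1 - l) * g y powr l \<le> h ((1 - l) *\<^sub>R x + l *\<^sub>R y)"
  shows "(\<integral>x. f x \<partial>lborel) powr (1 - l) * (\<integral>x. g x \<partial>lborel) powr l \<le> (\<integral>x. h x \<partial>lborel)"
  unfolding integral_nice_fun_prod[OF nice(1)] integral_nice_fun_prod[OF nice(2)] integral_nice_fun_prod[OF nice(3)]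
proof (rule PLa)
  fix x y :: 'a
  show "(\<integral>z. f (x, z) \<partial>lborel) powr (1 - l) * (\<integral>z. g (y, z) \<partial>lborel) powr l
    \<le> (\<integral>z. h ((1 - l) *\<^sub>R x + l *\<^sub>R y, z) \<partial>lborel)"
  proof (rule PLb)
    fix u v :: 'b
    show "f (x, u) powr (1 - l) * g (y, v) powr l \<le> h ((1 - l) *\<^sub>R x + l *\<^sub>R y, (1 - l) *\<^sub>R u + l *\<^sub>R v)"
      using h[of "(x, u)" "(y, v)"] by simp
  qed (intro nice_fun_slice nice)+
qed (intro nice_fun_integral_slice nice)+

text \<open>Two product steps, applied to indicator functions.\<close>

lemma brunn_minkowski_prod3:
  fixes A B D :: "(real \<times> real \<times> real) set"
  assumes A: "A \<in> sets borel" "bounded A" and B: "B \<in> sets borel" "bounded B" and D: "D \<in> sets borel" "bounded D"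
    and l: "0 < l" "l < 1"
    and sub: "\<And>a b. a \<in> A \<Longrightarrow> b \<in> B \<Longrightarrow> (1 - l) *\<^sub>R a + l *\<^sub>R b \<in> D"
  shows "measure lborel A powr (1 - l) * measure lborel B powr l \<le> measure lborel D"
proof -
  have nice: "nice_fun (indicator E :: _ \<Rightarrow> real)" if E: "E \<in> sets borel" "bounded E" for E :: "(real \<times> real \<times> real) set"
  proof -
    obtain R where "\<And>x. x \<in> E \<Longrightarrow> norm x \<le> R"
      using E(2) by (auto simp: bounded_iff)
    then have "\<forall>x. 0 \<le> (indicator E x :: real) \<and> (indicator E x :: real) \<le> 1 \<and> (norm x > R \<longrightarrow> (indicator E x :: real) = 0)"
      by (force simp: indicator_def not_less[symmetric])
    moreover have "(indicator E :: _ \<Rightarrow> real) \<in> borel_measurable borel"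
      using E(1) by simp
    ultimately show ?thesis
      unfolding nice_fun_def by blast
  qed
  note PL1 = prekopa_leindler_real[OF _ _ _ l]
  have "(\<integral>x. indicator A x \<partial>lborel) powr (1 - l) * (\<integral>x. indicator B x \<partial>lborel) powr l \<le> (\<integral>x. indicator D x \<partial>lborel :: real)"
    using A B D sub l
    by (intro prekopa_leindler_prod[OF PL1 prekopa_leindler_prod[OF PL1 PL1]] nice) (auto simp: indicator_def)
  then show ?thesis
    by simp
qed

section \<open>Transfer from iterated products to \<open>real^3\<close>\<close>

definition vec3 :: "real \<times> real \<times> real \<Rightarrow> real^3" where
  "vec3 p = fst p *\<^sub>R axis 1 1 + fst (snd p) *\<^sub>R axis 2 1 + snd (snd p) *\<^sub>R axis 3 1"

lemma vec3_nth [simp]: "vec3 (a, b, c) $ 1 = a" "vec3 (a, b, c) $ 2 = b" "vec3 (a, b, c) $ 3 = c"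
  by (simp_all add: vec3_def axis_def)

lemma vec3_measurable [measurable]: "vec3 \<in> borel_measurable borel"
  unfolding vec3_def[abs_def] by (intro borel_measurable_continuous_onI continuous_intros)

lemma emeasure_lborel_Times:
  fixes A :: "'a::euclidean_space set" and B :: "'b::euclidean_space set"
  assumes "A \<in> sets borel" "B \<in> sets borel"
  shows "emeasure lborel (A \<times> B) = emeasure lborel A * emeasure lborel B"
  using assms by (simp add: lborel.emeasure_pair_measure_Times flip: lborel_prod)

text \<open>Lebesgue measure is determined by its values on boxes, and the preimage of a box is a
  product of intervals.\<close>

lemma lborel_eq_distr_vec3: "lborel = distr lborel borel vec3"
proof (rule lborel_eqI)
  fix l u :: "real^3"
  assume lu: "\<And>b. b \<in> Basis \<Longrightarrow> l \<bullet> b \<le> u \<bullet> b"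
  have le: "l $ i \<le> u $ i" for i
    using lu[of "axis i 1"] by (simp add: inner_axis)
  have "vec3 -` box l u = box (l$1) (u$1) \<times> (box (l$2) (u$2) \<times> box (l$3) (u$3))"
    by (auto simp: mem_box_cart forall_3)
  then have "emeasure (distr lborel borel vec3) (box l u) =
      emeasure lborel (box (l$1) (u$1) \<times> (box (l$2) (u$2) \<times> box (l$3) (u$3)))"
    by (simp add: emeasure_distr)
  also have "\<dots> = ennreal (u$1 - l$1) * (ennreal (u$2 - l$2) * ennreal (u$3 - l$3))"
    unfolding emeasure_lborel_Times[OF borel_open[OF open_box] borel_open[OF open_Times[OF open_box open_box]]]
      emeasure_lborel_Times[OF borel_open[OF open_box] borel_open[OF open_box]]
    using le by simp
  also have "\<dots> = ennreal ((u$1 - l$1) * (u$2 - l$2) * (u$3 - l$3))"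
    using le by (simp only: ennreal_mult[symmetric] mult_nonneg_nonneg diff_ge_0_iff_ge mult.assoc)
  also have "(u$1 - l$1) * (u$2 - l$2) * (u$3 - l$3) = (\<Prod>i\<in>UNIV. (u - l) $ i)"
    unfolding UNIV_3 by (simp add: mult.assoc)
  also have "\<dots> = (\<Prod>b\<in>Basis. (u - l) \<bullet> b)"
  proof -
    have inj: "inj (\<lambda>i. axis i 1 :: real^3)"
      by (auto simp: inj_on_def axis_eq_axis)
    have "(Basis :: (real^3) set) = range (\<lambda>i. axis i 1)"
      by (auto simp: Basis_vec_def)
    then have "(\<Prod>b\<in>Basis. (u - l) \<bullet> b) = (\<Prod>b\<in>range (\<lambda>i. axis i 1). (u - l) \<bullet> b)"
      by (rule arg_cong)
    also have "\<dots> = (\<Prod>i\<in>UNIV. (u - l) \<bullet> axis i 1)"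
      unfolding prod.reindex[OF inj] o_def ..
    also have "\<dots> = (\<Prod>i\<in>UNIV. (u - l) $ i)"
      by (simp add: inner_axis)
    finally show ?thesis ..
  qed
  finally show "emeasure (distr lborel borel vec3) (box l u) = (\<Prod>b\<in>Basis. (u - l) \<bullet> b)" .
qed simp

lemma emeasure_vec3_vimage:
  "A \<in> sets borel \<Longrightarrow> emeasure lborel A = emeasure lborel (vec3 -` A)"
  by (subst lborel_eq_distr_vec3) (simp add: emeasure_distr)

lemma norm_vec3: "norm (vec3 p) = norm p"
  by (cases p) (simp add: norm_eq_sqrt_inner inner_vec_def sum_3)

lemma vec3_linear: "vec3 (a *\<^sub>R p + b *\<^sub>R q) = a *\<^sub>R vec3 p + b *\<^sub>R vec3 q"
  by (simp add: vec3_def algebra_simps)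

lemma brunn_minkowski_multiplicative:
  fixes A B D :: "(real^3) set"
  assumes A: "A \<in> sets borel" "bounded A" and B: "B \<in> sets borel" "bounded B" and D: "D \<in> sets borel" "bounded D"
    and l: "0 < l" "l < 1"
    and sub: "\<And>a b. a \<in> A \<Longrightarrow> b \<in> B \<Longrightarrow> (1 - l) *\<^sub>R a + l *\<^sub>R b \<in> D"
  shows "measure lborel A powr (1 - l) * measure lborel B powr l \<le> measure lborel D"
proof -
  have bor: "vec3 -` E \<in> sets borel" if "E \<in> sets borel" for E
    using measurable_sets[OF vec3_measurable that] by simp
  have bdd: "bounded (vec3 -` E)" if E: "bounded E" for E
  proof -
    obtain R where "\<And>x. x \<in> E \<Longrightarrow> norm x \<le> R"
      using E by (auto simp: bounded_iff)
    then show ?thesis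
      by (intro boundedI[of _ R]) (metis norm_vec3 vimageE)
  qed
  have "measure lborel E = measure lborel (vec3 -` E)" if "E \<in> sets borel" for E
    using emeasure_vec3_vimage[OF that] by (simp add: measure_def)
  then show ?thesis
    using brunn_minkowski_prod3[OF bor bdd bor bdd bor bdd l, of A B D] assms by (simp add: vec3_linear)
qed

text \<open>The additive form follows from the multiplicative one by rescaling: with l = b / (a +
  b), the dilates A / (1 - l) and the ball of radius r / l both have volume (a + b)^3, while their
  combination with weights 1 - l and l is \<open>A\<close> plus the ball of radius
  \<open>r\<close>.\<close>

lemma brunn_minkowski_ball:
  fixes A D :: "(real^3) set"
  assumes A: "A \<in> sets borel" "bounded A" "measure lborel A > 0" and D: "D \<in> sets borel" "bounded D" and r: "r > 0"
    and sub: "\<And>a v. a \<in> A \<Longrightarrow> norm v \<le> r \<Longrightarrow> a + v \<in> D"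
  shows "(root 3 (measure lborel A) + r * root 3 (4 / 3 * pi)) ^ 3 \<le> measure lborel D"
proof -
  define a where "a = root 3 (measure lborel A)"
  define b where "b = r * root 3 (4 / 3 * pi)"
  have ab: "a > 0" "b > 0"
    using A r by (simp_all add: a_def b_def)
  define l where "l = b / (a + b)"
  have l: "0 < l" "l < 1" and l1: "1 - l = a / (a + b)"
    using ab by (simp_all add: l_def field_simps)
  define A' where "A' = (\<lambda>x. (1 / (1 - l)) *\<^sub>R x + 0) ` A"
  define B' where "B' = cball (0 :: real^3) (r / l)"
  have "A' \<in> sets borel"
    unfolding A'_def using A l by (intro borel_affine_image) auto
  moreover have "bounded A'"
    unfolding A'_def using bounded_scaling[OF A(2)] by simp
  ultimately have A'b: "A' \<in> sets borel" "bounded A'" .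
  have "measure lborel A' = \<bar>1 / (1 - l)\<bar> ^ 3 * measure lborel A"
    using measure_lebesgue_affine[of "1 / (1 - l)" 0 A] A A'b by (simp add: A'_def measure_completion)
  also have "\<dots> = (a / (1 - l)) ^ 3"
    using A l by (simp add: a_def power_divide)
  also have "\<dots> = (a + b) ^ 3"
    using ab by (simp add: l1)
  finally have mA: "measure lborel A' = (a + b) ^ 3" .
  have "measure lborel B' = 4 / 3 * pi * (r / l) ^ 3"
    using r l by (simp add: B'_def content_cball_conv_ball content_ball unit_ball_vol_3)
  also have "\<dots> = (b / l) ^ 3"
    by (simp add: b_def power_divide power_mult_distrib)
  also have "\<dots> = (a + b) ^ 3"
    using ab by (simp add: l_def)
  finally have mB: "measure lborel B' = (a + b) ^ 3" .
  have "measure lborel A' powr (1 - l) * measure lborel B' powr l \<le> measure lborel D"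
  proof (rule brunn_minkowski_multiplicative[OF A'b _ _ D l])
    fix x y assume "x \<in> A'" "y \<in> B'"
    then obtain z where z: "z \<in> A" "x = (1 / (1 - l)) *\<^sub>R z" and y: "norm y \<le> r / l"
      by (auto simp: A'_def B'_def)
    have "norm (l *\<^sub>R y) \<le> r"
      using y l by (simp add: field_simps)
    with z l show "(1 - l) *\<^sub>R x + l *\<^sub>R y \<in> D"
      using sub by simp
  qed (auto simp: B'_def)
  moreover have "(a + b) ^ 3 = ((a + b) ^ 3) powr (1 - l) * ((a + b) ^ 3) powr l"
    using ab by (simp flip: powr_add)
  ultimately show ?thesis
    by (simp add: mA mB a_def b_def)
qed

subsection \<open>Spherical sectors\<close>

definition sector :: "real \<Rightarrow> real^3 \<Rightarrow> (real^3) set" where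
  "sector c v = {x \<in> cball 0 1. c * norm x \<le> x \<bullet> v}"

lemma closed_sector: "closed (sector c v)"
proof -
  have "sector c v = cball 0 1 \<inter> {x. c * norm x \<le> x \<bullet> v}"
    by (auto simp: sector_def)
  then show ?thesis
    by (auto intro!: closed_Int closed_Collect_le continuous_intros)
qed

lemma sector_lmeasurable [simp]: "sector c v \<in> lmeasurable"
proof -
  have "bounded (sector c v)"
    by (rule bounded_subset[OF bounded_cball[of 0 1]]) (auto simp: sector_def)
  then show ?thesis
    using closed_sector by (intro lmeasurable_compact) (simp add: compact_eq_bounded_closed)
qed

section \<open>Volume of a spherical sector\<close>

lemma emeasure_cball_prod:
  assumes "r \<ge> 0"
  shows "emeasure lborel (cball (0 :: real \<times> real) r) = ennreal (pi * r\<^sup>2)"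
  using assms by (simp add: emeasure_cball unit_ball_vol_2 power2_eq_square)

lemma nn_integral_square_Icc:
  assumes "0 \<le> c" "0 \<le> k"
  shows "(\<integral>\<^sup>+z\<in>{0..c}. ennreal (k * z\<^sup>2) \<partial>lborel) = ennreal (k * c ^ 3 / 3)"
proof -
  have "((\<lambda>z. k * z ^ 3 / 3) has_real_derivative k * z\<^sup>2) (at z)" for z
    by (auto intro!: derivative_eq_intros)
  then show ?thesis
    using nn_integral_FTC_Icc[of "\<lambda>z. k * z\<^sup>2" 0 c "\<lambda>z. k * z ^ 3 / 3"] assms by simp
qed

lemma nn_integral_parabola_Icc:
  assumes "0 \<le> c" "c \<le> 1"
  shows "(\<integral>\<^sup>+z\<in>{c..1}. ennreal (pi * (1 - z\<^sup>2)) \<partial>lborel) = ennreal (pi * (2/3 - c + c ^ 3 / 3))"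
proof -
  have "((\<lambda>z. pi * (z - z ^ 3 / 3)) has_real_derivative pi * (1 - z\<^sup>2)) (at z)" for z
    by (auto intro!: derivative_eq_intros)
  moreover have "0 \<le> pi * (1 - z\<^sup>2)" if "z \<in> {c..1}" for z
    using that assms by (auto intro!: mult_nonneg_nonneg power_le_one)
  ultimately show ?thesis
    using nn_integral_FTC_Icc[of "\<lambda>z. pi * (1 - z\<^sup>2)" c 1 "\<lambda>z. pi * (z - z ^ 3 / 3)"] assms
    by (simp add: algebra_simps)
qed

text \<open>Slices orthogonal to the axis are discs: those of a cone up to height \<open>c\<close>,
  and those of a spherical cap from there on.\<close>

lemma measure_sector_axis:
  assumes c: "0 < c" "c < 1"
  shows "measure lborel (sector c (axis 1 1)) = 2 / 3 * pi * (1 - c)"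
proof -
  \<comment> \<open>The squared tangent of the half-angle, so the cone has squared radius k z^2 at
    height \<open>z\<close>.\<close>
  define k where "k = 1 / c\<^sup>2 - 1"
  have "k \<ge> 0"
    using c by (simp add: k_def field_simps power_le_one)
  define S where "S = {p :: real \<times> real \<times> real. norm p \<le> 1 \<and> c * norm p \<le> fst p}"
  have S: "vec3 -` sector c (axis 1 1) = S"
  proof -
    have "vec3 p \<bullet> axis 1 1 = fst p" for p
      by (cases p) (simp add: inner_axis)
    then show ?thesis
      by (auto simp: S_def sector_def norm_vec3)
  qed
  have "closed S"
    unfolding S_def by (intro closed_Collect_conj closed_Collect_le continuous_intros)
  then have Sb: "S \<in> sets borel"
    by simp
  have slice: "Pair z -` S = (if z \<in> {0..c} then cball 0 (sqrt (k * z\<^sup>2)) else if z \<in> {c..1} then cball 0 (sqrt (1 - z\<^sup>2)) else {})" for z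
  proof -
    have "w \<in> Pair z -` S \<longleftrightarrow> 0 \<le> z \<and> (norm w)\<^sup>2 \<le> 1 - z\<^sup>2 \<and> (norm w)\<^sup>2 \<le> k * z\<^sup>2" for w
    proof -
      have n: "(norm (z, w))\<^sup>2 = z\<^sup>2 + (norm w)\<^sup>2"
        by (simp add: norm_Pair)
      have "norm (z, w) \<le> 1 \<longleftrightarrow> (norm w)\<^sup>2 \<le> 1 - z\<^sup>2"
        using abs_square_le_1[of "norm (z, w)"] n by auto
      moreover have "c * norm (z, w) \<le> z \<longleftrightarrow> 0 \<le> z \<and> (norm w)\<^sup>2 \<le> k * z\<^sup>2"
      proof (cases "0 \<le> z")
        case True
        have "c * norm (z, w) \<le> z \<longleftrightarrow> (c * norm (z, w))\<^sup>2 \<le> z\<^sup>2"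
          using True c by (simp add: power2_le_iff_abs_le)
        also have "\<dots> \<longleftrightarrow> c\<^sup>2 * (z\<^sup>2 + (norm w)\<^sup>2) \<le> z\<^sup>2"
          by (simp add: power_mult_distrib n)
        also have "\<dots> \<longleftrightarrow> (norm w)\<^sup>2 \<le> k * z\<^sup>2"
          using c by (simp add: k_def field_simps)
        finally show ?thesis
          using True by simp
      next
        case False
        have "0 \<le> c * norm (z, w)"
          using c by simp
        with False show ?thesis
          by linarith
      qed
      ultimately show ?thesis
        by (auto simp: S_def)
    qed
    then have mem: "w \<in> Pair z -` S \<longleftrightarrow> 0 \<le> z \<and> (norm w)\<^sup>2 \<le> 1 - z\<^sup>2 \<and> (norm w)\<^sup>2 \<le> k * z\<^sup>2" for w .
    have le1: "k * z\<^sup>2 \<le> 1 - z\<^sup>2" if "0 \<le> z" "z \<le> c"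
    proof -
      have "z\<^sup>2 \<le> c\<^sup>2"
        using that by (intro power_mono)
      then show ?thesis
        using c by (simp add: k_def field_simps)
    qed
    have le2: "1 - z\<^sup>2 \<le> k * z\<^sup>2" if "c \<le> z"
    proof -
      have "c\<^sup>2 \<le> z\<^sup>2"
        using that c by (intro power_mono) auto
      then show ?thesis
        using c by (simp add: k_def field_simps)
    qed
    have sq: "norm w \<le> sqrt a \<longleftrightarrow> (norm w)\<^sup>2 \<le> a" for w :: "real \<times> real" and a
      by (metis norm_ge_zero real_le_rsqrt real_sqrt_le_iff real_sqrt_unique)
    have gt: "1 - z\<^sup>2 < 0" if "z > 1"
      using that by (simp add: power2_eq_square less_1_mult)
    show ?thesis
    proof (rule set_eqI)
      fix w
      consider "z < 0" | "0 \<le> z" "z \<le> c" | "c < z" "z \<le> 1" | "1 < z"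
        by linarith
      then show "w \<in> Pair z -` S \<longleftrightarrow> w \<in> (if z \<in> {0..c} then cball 0 (sqrt (k * z\<^sup>2))
          else if z \<in> {c..1} then cball 0 (sqrt (1 - z\<^sup>2)) else {})"
      proof cases
        case 1
        then show ?thesis
          unfolding mem using c by simp
      next
        case 2
        then show ?thesis
          unfolding mem using le1 sq[of w "k * z\<^sup>2"] by auto
      next
        case 3
        then show ?thesis
          unfolding mem using le2 c sq[of w "1 - z\<^sup>2"] by auto
      next
        case 4
        have "\<not> (norm w)\<^sup>2 \<le> 1 - z\<^sup>2"
          using gt[OF 4] zero_le_power2[of "norm w"] by linarith
        then show ?thesis
          unfolding mem using 4 c by simp
      qed
    qed
  qed
  have "emeasure lborel (sector c (axis 1 1)) = emeasure lborel S"
    using emeasure_vec3_vimage[of "sector c (axis 1 1)"] closed_sector by (simp add: S)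
  also have "\<dots> = (\<integral>\<^sup>+z. emeasure lborel (Pair z -` S) \<partial>lborel)"
    using lborel.emeasure_pair_measure_alt[of S lborel] Sb unfolding lborel_prod by simp
  also have "\<dots> = (\<integral>\<^sup>+z. ennreal (pi * k * z\<^sup>2) * indicator {0..c} z + ennreal (pi * (1 - z\<^sup>2)) * indicator {c..1} z \<partial>lborel)"
  proof (intro nn_integral_cong_AE)
    \<comment> \<open>At z = c both indicators are 1 and the slice would be counted twice.\<close>
    have "AE z in lborel. z \<noteq> c"
      by (rule AE_lborel_singleton)
    then show "AE z in lborel. emeasure lborel (Pair z -` S) = ennreal (pi * k * z\<^sup>2) * indicator {0..c} z + ennreal (pi * (1 - z\<^sup>2)) * indicator {c..1} z"
    proof eventually_elim
      case (elim z)
      have "0 \<le> 1 - z\<^sup>2" if "c \<le> z" "z \<le> 1"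
        using that c by (simp add: power_le_one)
      then show ?case
        using elim \<open>k \<ge> 0\<close> c by (auto simp: slice emeasure_cball_prod indicator_def mult.assoc)
    qed
  qed
  also have "\<dots> = ennreal (pi * k * c ^ 3 / 3) + ennreal (pi * (2/3 - c + c ^ 3 / 3))"
    using \<open>k \<ge> 0\<close> c nn_integral_square_Icc[of c "pi * k"] nn_integral_parabola_Icc[of c]
    by (simp add: nn_integral_add)
  also have "\<dots> = ennreal (pi * k * c ^ 3 / 3 + pi * (2/3 - c + c ^ 3 / 3))"
  proof (rule ennreal_plus[symmetric])
    have eq: "2/3 - c + c ^ 3 / 3 = (1 - c)\<^sup>2 * (2 + c) / 3"
      by (simp add: power2_eq_square power3_eq_cube field_simps)
    show "0 \<le> pi * (2/3 - c + c ^ 3 / 3)"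
      unfolding eq using c by simp
  qed (use \<open>k \<ge> 0\<close> c in auto)
  also have "pi * k * c ^ 3 / 3 + pi * (2/3 - c + c ^ 3 / 3) = 2 / 3 * pi * (1 - c)"
    using c by (simp add: k_def power2_eq_square power3_eq_cube field_simps)
  finally show ?thesis
    using c by (simp add: measure_def)
qed

lemma measure_sector:
  assumes c: "0 < c" "c < 1" and v: "norm v = 1"
  shows "measure lebesgue (sector c v) = 2 / 3 * pi * (1 - c)"
proof -
  obtain f :: "real^3 \<Rightarrow> real^3" where f: "orthogonal_transformation f" "f (axis 1 1) = v"
    using orthogonal_transformation_exists[of "axis 1 1" v] v by (auto simp: norm_axis_1)
  have "sector c v = f ` sector c (axis 1 1)"
  proof
    show "f ` sector c (axis 1 1) \<subseteq> sector c v"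
    proof clarify
      fix x assume "x \<in> sector c (axis 1 1)"
      moreover have "f x \<bullet> v = x \<bullet> axis 1 1" "norm (f x) = norm x"
        using f by (auto simp: orthogonal_transformation_def orthogonal_transformation_norm)
      ultimately show "f x \<in> sector c v"
        by (simp add: sector_def)
    qed
    show "sector c v \<subseteq> f ` sector c (axis 1 1)"
    proof
      fix y assume y: "y \<in> sector c v"
      obtain x where x: "y = f x"
        using orthogonal_transformation_surj[OF f(1)] by (auto simp: surj_def)
      have "f x \<bullet> v = x \<bullet> axis 1 1" "norm (f x) = norm x"
        using f by (auto simp: orthogonal_transformation_def orthogonal_transformation_norm)
      with y show "y \<in> f ` sector c (axis 1 1)"
        by (auto simp: sector_def x)
    qed
  qed
  then have "measure lebesgue (sector c v) = measure lebesgue (sector c (axis 1 1))"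
    using measure_orthogonal_image[OF f(1) sector_lmeasurable] by simp
  also have "\<dots> = measure lborel (sector c (axis 1 1))"
    using closed_sector by (intro measure_completion) simp
  finally show ?thesis
    using measure_sector_axis[OF c] by simp
qed

subsection \<open>Directions free of contacts\<close>

definition free_cone :: "(real^3) set \<Rightarrow> (real^3) set" where
  "free_cone V = {x. x \<noteq> 0 \<and> (\<forall>v\<in>V. x \<bullet> v < norm x / 2)}"

lemma free_cone_scale:
  assumes "r > 0"
  shows "r *\<^sub>R x \<in> free_cone V \<longleftrightarrow> x \<in> free_cone V"
  using assms by (auto simp: free_cone_def)

lemma free_cone_borel:
  assumes "finite V"
  shows "free_cone V \<in> sets borel"
proof -
  have "open {x. x \<noteq> (0 :: real^3)}" "open {x. \<forall>v\<in>V. x \<bullet> v < norm x / 2}"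
    using assms
    by (auto intro!: open_Collect_less continuous_intros open_Collect_neq simp: Collect_ball_eq open_INT)
  then have "open ({x. x \<noteq> 0} \<inter> {x. \<forall>v\<in>V. x \<bullet> v < norm x / 2})"
    by (rule open_Int)
  also have "{x. x \<noteq> 0} \<inter> {x. \<forall>v\<in>V. x \<bullet> v < norm x / 2} = free_cone V"
    by (auto simp: free_cone_def)
  finally show ?thesis
    by simp
qed

text \<open>Split off the components along \<open>u\<close>. The remainders have inner product at
  least minus the mean of their squared norms, whence v . w is at least a b - 1 + (a^2 + b^2) / 2,
  and 2 (867/1000)^2 - 1 > 1/2.\<close>

lemma inner_gt_half_of_common_neighbour:
  fixes u v w :: "'a::real_inner"
  assumes n: "norm u = 1" "norm v = 1" "norm w = 1" and uv: "u \<bullet> v \<ge> 867/1000" and uw: "u \<bullet> w \<ge> 867/1000"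
  shows "v \<bullet> w > 1/2"
proof -
  define a b where "a = u \<bullet> v" and "b = u \<bullet> w"
  define v' w' where "v' = v - a *\<^sub>R u" and "w' = w - b *\<^sub>R u"
  have vv: "v' \<bullet> v' = 1 - a\<^sup>2" and ww: "w' \<bullet> w' = 1 - b\<^sup>2" and vw: "v' \<bullet> w' = v \<bullet> w - a * b"
    using n by (simp_all add: v'_def w'_def a_def b_def inner_diff_left inner_diff_right inner_commute norm_eq_1 power2_eq_square)
  have "a * a \<ge> 867/1000 * (867/1000)" "b * b \<ge> 867/1000 * (867/1000)" "a * b \<ge> 867/1000 * (867/1000)"
    using uv uw by (intro mult_mono; simp add: a_def b_def)+
  moreover have "0 \<le> (v' + w') \<bullet> (v' + w')"
    by simp
  then have "0 \<le> (1 - a\<^sup>2) + (1 - b\<^sup>2) + 2 * (v \<bullet> w - a * b)"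
    using vv ww vw by (simp add: inner_add_left inner_add_right inner_commute)
  ultimately show ?thesis
    by (simp add: power2_eq_square)
qed

locale kissing_configuration =
  fixes V :: "(real^3) set"
  assumes finite: "finite V" and unit: "V \<subseteq> sphere 0 1"
    and sep: "v \<in> V \<Longrightarrow> w \<in> V \<Longrightarrow> v \<noteq> w \<Longrightarrow> v \<bullet> w \<le> 1/2"
begin

lemma insert_free_direction:
  assumes "x \<in> free_cone V"
  shows "kissing_configuration (insert (sgn x) V)" and "sgn x \<notin> V"
proof -
  have "x \<noteq> 0" and lt: "sgn x \<bullet> v < 1/2" if "v \<in> V" for v
    using assms that by (auto simp: free_cone_def sgn_div_norm field_simps)
  have "x \<noteq> 0"
    using assms by (simp add: free_cone_def)
  show "kissing_configuration (insert (sgn x) V)"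
    using finite unit sep lt \<open>x \<noteq> 0\<close>
    by unfold_locales (auto simp: norm_sgn inner_commute less_imp_le)
  show "sgn x \<notin> V"
    using lt[of "sgn x"] \<open>x \<noteq> 0\<close> by (auto simp: norm_sgn simp flip: power2_norm_eq_inner)
qed

lemma card_le_12: "card V \<le> 12"
  using kissing_number_3 finite unit sep by blast

lemma free_cone_empty:
  assumes "card V = 12"
  shows "free_cone V = {}"
proof (rule ccontr)
  assume "free_cone V \<noteq> {}"
  then obtain x where x: "x \<in> free_cone V"
    by blast
  interpret W: kissing_configuration "insert (sgn x) V"
    using insert_free_direction(1)[OF x] .
  show False
    using W.card_le_12 insert_free_direction(2)[OF x] finite assms by simp
qed

text \<open>Two free directions at least 60 degrees apart could both be added, giving a
  configuration of 13 vectors.\<close>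

lemma free_directions_close:
  assumes "card V = 11" "x \<in> free_cone V" "y \<in> free_cone V"
  shows "sgn x \<bullet> sgn y > 1/2"
proof (rule ccontr)
  assume *: "\<not> sgn x \<bullet> sgn y > 1/2"
  interpret W: kissing_configuration "insert (sgn x) V"
    using insert_free_direction(1)[OF assms(2)] .
  have nz: "x \<noteq> 0" "y \<noteq> 0" and yV: "\<And>v. v \<in> V \<Longrightarrow> y \<bullet> v < norm y / 2"
    using assms by (auto simp: free_cone_def)
  have ny: "sgn y \<noteq> sgn x"
    using * nz by (auto simp: norm_sgn simp flip: power2_norm_eq_inner)
  have yV': "sgn y \<bullet> v < 1/2" if "v \<in> V" for v
    using yV[OF that] nz by (auto simp: sgn_div_norm field_simps)
  interpret W2: kissing_configuration "insert (sgn y) (insert (sgn x) V)"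
    using W.finite W.unit W.sep * yV' nz
    by unfold_locales (auto simp: norm_sgn inner_commute less_imp_le)
  have "sgn y \<notin> V"
    using yV'[of "sgn y"] nz by (auto simp: norm_sgn simp flip: power2_norm_eq_inner)
  then have "card (insert (sgn y) (insert (sgn x) V)) = 13"
    using insert_free_direction(2)[OF assms(2)] finite assms(1) ny by simp
  then show False
    using W2.card_le_12 by simp
qed

text \<open>The axis is the direction of the point nearest to the origin in the closed convex hull
  of the free directions; 7/10 is 1/sqrt 2 rounded down.\<close>

lemma free_cone_subset_sector:
  assumes "card V = 11" "free_cone V \<noteq> {}"
  obtains z where "norm z = 1" "free_cone V \<inter> cball 0 1 \<subseteq> sector (7/10) z"
proof -
  define R where "R = sgn ` free_cone V"
  define S where "S = closure (convex hull R)"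
  have S: "convex S" "closed S" "S \<noteq> {}" "R \<subseteq> S"
    using assms(2) hull_subset[of R convex] closure_subset[of "convex hull R"]
    by (auto simp: S_def R_def intro: convex_closure)
  have halfspace: "S \<subseteq> {y. u \<bullet> y \<ge> 1/2}" if "R \<subseteq> {y. u \<bullet> y \<ge> 1/2}" for u
    unfolding S_def using that
    by (intro closure_minimal hull_minimal convex_halfspace_ge closed_halfspace_ge)
  \<comment> \<open>The bound is affine in each argument separately, so it passes to the closed hull
    first in one and then in the other.\<close>
  have "S \<subseteq> {y. u \<bullet> y \<ge> 1/2}" if "u \<in> R" for u
  proof (rule halfspace)
    show "R \<subseteq> {y. u \<bullet> y \<ge> 1/2}"
      using that free_directions_close[OF assms(1)] by (force simp: R_def)
  qed
  then have "S \<subseteq> {y. u \<bullet> y \<ge> 1/2}" if "u \<in> S" for u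
    using that by (intro halfspace) (force simp: inner_commute)
  then have SS: "u \<bullet> y \<ge> 1/2" if "u \<in> S" "y \<in> S" for u y
    using that by blast
  \<comment> \<open>All inner products on the hull are at least \<open>1/2\<close>, so its point nearest to the origin is long.\<close>
  define z where "z = closest_point S 0"
  have "z \<in> S"
    unfolding z_def using S by (intro closest_point_in_set)
  have zz: "z \<bullet> z \<ge> 1/2"
    using SS \<open>z \<in> S\<close> by blast
  have "(7/10)\<^sup>2 \<le> (norm z)\<^sup>2"
    unfolding power2_norm_eq_inner using zz by (simp add: power_divide)
  then have "norm z \<ge> 7/10"
    by (rule power2_le_imp_le) simp
  \<comment> \<open>The convex set lies beyond the plane through its nearest point \<open>z\<close>
    orthogonal to \<open>z\<close>.\<close>
  have zu: "z \<bullet> z \<le> u \<bullet> z" if "u \<in> R" for u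
    using closest_point_dot[OF S(1,2), of u 0] that S(4) by (auto simp: z_def inner_diff_right inner_commute)
  have dir: "norm z \<le> u \<bullet> sgn z" if "u \<in> R" for u
  proof -
    have "norm z * norm z \<le> u \<bullet> z"
      using zu[OF that] by (simp add: dot_square_norm power2_eq_square)
    moreover have "u \<bullet> sgn z = (u \<bullet> z) / norm z"
      by (simp add: sgn_div_norm divide_inverse)
    moreover have "norm z > 0"
      using \<open>norm z \<ge> 7/10\<close> by linarith
    ultimately show ?thesis
      by (simp add: pos_le_divide_eq)
  qed
  show ?thesis
  proof
    show "norm (sgn z) = 1"
      using \<open>norm z \<ge> 7/10\<close> by (auto simp: norm_sgn)
    show "free_cone V \<inter> cball 0 1 \<subseteq> sector (7/10) (sgn z)"
    proof
      fix x assume x: "x \<in> free_cone V \<inter> cball 0 1"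
      then have "7/10 \<le> sgn x \<bullet> sgn z"
        using dir[of "sgn x"] \<open>norm z \<ge> 7/10\<close> by (auto simp: R_def)
      moreover have "x \<bullet> sgn z = norm x * (sgn x \<bullet> sgn z)"
        by (cases "x = 0") (simp_all add: sgn_div_norm)
      moreover have "norm x * (7/10) \<le> norm x * (sgn x \<bullet> sgn z)"
        using calculation(1) by (intro mult_left_mono) auto
      ultimately show "x \<in> sector (7/10) (sgn z)"
        using x by (simp add: sector_def)
    qed
  qed
qed

text \<open>The cosine \<open>867/1000\<close> lies slightly above \<open>cos 30\<degree>\<close>, and \<open>133/2000\<close> is the relative volume of its sector.\<close>

lemma measure_free_cone_few:
  "measure lebesgue (free_cone V \<inter> cball 0 1) \<le> (1 - real (card V) * (133/2000)) * (4/3 * pi)"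
proof -
  let ?K = "free_cone V \<inter> cball 0 1"
  let ?c = "867/1000 :: real"
  have K: "?K \<in> lmeasurable"
    using free_cone_borel[OF finite] by (intro lmeasurable_bounded_borel) auto
  \<comment> \<open>A common direction of two sectors would bring their axes closer than 60 degrees,
    so they share only the apex.\<close>
  have disj_sectors: "negligible (sector ?c v \<inter> sector ?c w)" if "v \<in> V" "w \<in> V" "v \<noteq> w" for v w
  proof -
    have "sector ?c v \<inter> sector ?c w \<subseteq> {0}"
    proof
      fix x assume x: "x \<in> sector ?c v \<inter> sector ?c w"
      show "x \<in> {0}"
      proof (rule ccontr)
        assume "x \<notin> {0}"
        then have "sgn x \<bullet> v \<ge> ?c" "sgn x \<bullet> w \<ge> ?c" "norm (sgn x) = 1"
          using x by (auto simp: sector_def sgn_div_norm field_simps norm_sgn)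
        moreover have "norm v = 1" "norm w = 1"
          using unit that by auto
        ultimately have "v \<bullet> w > 1/2"
          by (intro inner_gt_half_of_common_neighbour[of "sgn x"])
        with sep that show False by force
      qed
    qed
    then show ?thesis
      using negligible_subset negligible_sing by blast
  qed
  have "negligible (?K \<inter> (\<Union>v\<in>V. sector ?c v))"
  proof -
    have "?K \<inter> (\<Union>v\<in>V. sector ?c v) = {}"
    proof -
      have False if "x \<in> ?K" "v \<in> V" "x \<in> sector ?c v" for x v
      proof -
        have "x \<bullet> v < norm x / 2" "norm x > 0" "?c * norm x \<le> x \<bullet> v"
          using that by (auto simp: free_cone_def sector_def)
        then show False by linarith
      qed
      then show ?thesis by blast
    qed
    then show ?thesis by simp
  qed
  moreover have U: "(\<Union>v\<in>V. sector ?c v) \<in> lmeasurable"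
    using finite by (intro fmeasurable.finite_UN) auto
  ultimately have "measure lebesgue ?K + measure lebesgue (\<Union>v\<in>V. sector ?c v) = measure lebesgue (?K \<union> (\<Union>v\<in>V. sector ?c v))"
    using K by (simp add: measure_Un3 negligible_imp_measure0)
  also have "\<dots> \<le> measure lebesgue (cball (0 :: real^3) 1)"
    using K U by (intro measure_mono_fmeasurable) (auto simp: sector_def)
  also have "\<dots> = 4/3 * pi"
    by (simp add: content_cball_conv_ball content_ball unit_ball_vol_3)
  also have "measure lebesgue (\<Union>v\<in>V. sector ?c v) = (\<Sum>v\<in>V. measure lebesgue (sector ?c v))"
    using finite disj_sectors by (intro measure_negligible_finite_Union_image) (auto simp: pairwise_def)
  also have "\<dots> = (\<Sum>v\<in>V. 2/3 * pi * (1 - ?c))"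
    using unit by (intro sum.cong refl measure_sector) auto
  finally show ?thesis
    by (simp add: algebra_simps)
qed

text \<open>The constant is governed by 10 contacts, where removing caps leaves the fraction 0.335,
  against the allowed 0.34. With 11 contacts the sector of cosine 7/10 has fraction 0.15.\<close>

lemma measure_free_cone_le:
  "measure lebesgue (free_cone V \<inter> cball 0 1) \<le> 17/100 * (12 - real (card V)) * (4/3 * pi)"
proof -
  consider "card V = 12" | "card V = 11" | "card V \<le> 10"
    using card_le_12 by linarith
  then show ?thesis
  proof cases
    case 1
    then show ?thesis
      using free_cone_empty by simp
  next
    case 2
    show ?thesis
    proof (cases "free_cone V = {}")
      case False
      then obtain z where z: "norm z = 1" "free_cone V \<inter> cball 0 1 \<subseteq> sector (7/10) z"
        using free_cone_subset_sector[OF 2] by blast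
      have "measure lebesgue (free_cone V \<inter> cball 0 1) \<le> measure lebesgue (sector (7/10) z)"
        using z(2) free_cone_borel[OF finite]
        by (intro measure_mono_fmeasurable) (auto intro!: fmeasurableD lmeasurable_bounded_borel)
      also have "\<dots> = 2/3 * pi * (3/10)"
        using measure_sector[of "7/10" z] z by simp
      also have "\<dots> \<le> 17/100 * (12 - real (card V)) * (4/3 * pi)"
        unfolding 2 by simp
      finally show ?thesis .
    qed (use 2 in simp)
  next
    case 3
    have "(1 - real (card V) * (133/2000)) * (4/3 * pi) \<le> 17/100 * (12 - real (card V)) * (4/3 * pi)"
      using 3 by (intro mult_right_mono) auto
    then show ?thesis
      using measure_free_cone_few by linarith
  qed
qed

end

subsection \<open>Packings\<close>

lemma packing_dist_ge_2:
  assumes "unit_ball_packing P" "p \<in> P" "q \<in> P" "p \<noteq> q"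
  shows "dist p q \<ge> 2"
proof (rule ccontr)
  assume "\<not> dist p q \<ge> 2"
  then have "midpoint p q \<in> ball p 1 \<inter> ball q 1"
    by (simp add: dist_midpoint)
  with assms show False
    unfolding unit_ball_packing_def by blast
qed

definition contacts :: "(real^3) set \<Rightarrow> real^3 \<Rightarrow> (real^3) set" where
  "contacts P p = {q \<in> P. dist p q = 2}"

lemma sum_card_contacts:
  assumes "finite P"
  shows "(\<Sum>p\<in>P. card (contacts P p)) = 2 * contact_number P"
proof -
  define D where "D = Sigma P (contacts P)"
  define f where "f = (\<lambda>(p, q). {p, q :: real^3})"
  have "finite D"
    using assms by (auto simp: D_def contacts_def)
  have E: "{{p, q} | p q. p \<in> P \<and> q \<in> P \<and> dist p q = 2} = f ` D"
    by (force simp: D_def f_def contacts_def image_iff)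
  have fiber: "card {x \<in> D. f x = e} = 2" if e: "e \<in> f ` D" for e
  proof -
    obtain p q where pq: "p \<in> P" "q \<in> P" "dist p q = 2" "e = {p, q}"
      using e by (auto simp: D_def f_def contacts_def)
    then have mem: "(p, q) \<in> D" "(q, p) \<in> D"
      by (simp_all add: D_def contacts_def dist_commute)
    have "f x = e \<longleftrightarrow> x = (p, q) \<or> x = (q, p)" for x
      by (cases x) (simp add: f_def pq(4) doubleton_eq_iff)
    then have "{x \<in> D. f x = e} = {(p, q), (q, p)}"
      using mem by auto
    moreover have "p \<noteq> q"
      using pq by auto
    ultimately show ?thesis
      by simp
  qed
  have "(\<Sum>p\<in>P. card (contacts P p)) = card D"
    using assms by (simp add: D_def contacts_def card_SigmaI)
  also have "\<dots> = (\<Sum>x\<in>D. 1)"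
    by simp
  also have "\<dots> = (\<Sum>e\<in>f ` D. \<Sum>x\<in>{x \<in> D. f x = e}. 1)"
    using \<open>finite D\<close> by (rule sum.image_gen)
  also have "\<dots> = (\<Sum>e\<in>f ` D. 2)"
    using fiber by (intro sum.cong) auto
  finally show ?thesis
    by (simp add: contact_number_def E)
qed

definition contact_directions :: "(real^3) set \<Rightarrow> real^3 \<Rightarrow> (real^3) set" where
  "contact_directions P p = (\<lambda>q. (1/2) *\<^sub>R (q - p)) ` contacts P p"

lemma card_contact_directions: "card (contact_directions P p) = card (contacts P p)"
  unfolding contact_directions_def by (intro card_image) (auto simp: inj_on_def)

text \<open>Centres at distance at least 2 give unit vectors at distance at least 1, hence at least
  60 degrees apart.\<close>

lemma kissing_configuration_contact_directions:
  assumes "unit_ball_packing P"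
  shows "kissing_configuration (contact_directions P p)"
proof
  show "finite (contact_directions P p)"
    using assms by (simp add: contact_directions_def contacts_def unit_ball_packing_def)
  have unit: "norm v = 1" if "v \<in> contact_directions P p" for v
    using that by (auto simp: contact_directions_def contacts_def dist_norm norm_minus_commute)
  then show "contact_directions P p \<subseteq> sphere 0 1"
    by auto
  show "v \<bullet> w \<le> 1/2" if vw: "v \<in> contact_directions P p" "w \<in> contact_directions P p" "v \<noteq> w" for v w
  proof -
    obtain q r where qr: "q \<in> P" "r \<in> P" "v = (1/2) *\<^sub>R (q - p)" "w = (1/2) *\<^sub>R (r - p)"
      using vw by (auto simp: contact_directions_def contacts_def)
    have "v - w = (1/2) *\<^sub>R (q - r)"
      unfolding qr(3,4) by (simp add: scaleR_diff_right)
    then have "norm (v - w) = dist q r / 2"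
      by (simp add: dist_norm)
    moreover have "dist q r \<ge> 2"
      using packing_dist_ge_2[OF assms] qr vw(3) by blast
    ultimately have "1 \<le> (norm (v - w))\<^sup>2"
      by simp
    also have "\<dots> = v \<bullet> v + w \<bullet> w - 2 * (v \<bullet> w)"
      unfolding power2_norm_eq_inner by (simp add: inner_diff_left inner_diff_right inner_commute)
    also have "\<dots> = 2 - 2 * (v \<bullet> w)"
      using unit[OF vw(1)] unit[OF vw(2)] by (simp add: norm_eq_1)
    finally show ?thesis
      by simp
  qed
qed

section \<open>The shell between two enlargements of the packing\<close>

lemma free_cone_cball_scale:
  assumes "r > 0"
  shows "free_cone V \<inter> cball 0 r = (\<lambda>x. r *\<^sub>R x + 0) ` (free_cone V \<inter> cball 0 1)"
proof
  show "(\<lambda>x. r *\<^sub>R x + 0) ` (free_cone V \<inter> cball 0 1) \<subseteq> free_cone V \<inter> cball 0 r"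
    using assms by (auto simp: free_cone_scale)
  show "free_cone V \<inter> cball 0 r \<subseteq> (\<lambda>x. r *\<^sub>R x + 0) ` (free_cone V \<inter> cball 0 1)"
  proof
    fix y assume y: "y \<in> free_cone V \<inter> cball 0 r"
    then have "(1 / r) *\<^sub>R y \<in> free_cone V \<inter> cball 0 1"
      using assms by (simp add: free_cone_scale)
    moreover have "y = r *\<^sub>R ((1 / r) *\<^sub>R y) + 0"
      using assms by simp
    ultimately show "y \<in> (\<lambda>x. r *\<^sub>R x + 0) ` (free_cone V \<inter> cball 0 1)"
      by blast
  qed
qed

lemma measure_free_cone_shell:
  assumes "finite V" "0 < r" "r \<le> s"
  shows "free_cone V \<inter> cball 0 s - cball 0 r \<in> lmeasurable" (is ?lm)
    and "measure lebesgue (free_cone V \<inter> cball 0 s - cball 0 r) =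
      (s ^ 3 - r ^ 3) * measure lebesgue (free_cone V \<inter> cball 0 1)" (is ?eq)
proof -
  have lm: "free_cone V \<inter> cball 0 t \<in> lmeasurable" for t
    using free_cone_borel[OF assms(1)] by (intro lmeasurable_bounded_borel) auto
  have meas: "measure lebesgue (free_cone V \<inter> cball 0 t) = t ^ 3 * measure lebesgue (free_cone V \<inter> cball 0 1)" if "t > 0" for t
    unfolding free_cone_cball_scale[OF that] measure_lebesgue_affine using that by simp
  have eq: "free_cone V \<inter> cball 0 s - cball 0 r = free_cone V \<inter> cball 0 s - (free_cone V \<inter> cball 0 r)"
    by auto
  show ?lm
    unfolding eq using lm by (intro fmeasurable.Diff)
  have "measure lebesgue (free_cone V \<inter> cball 0 s - cball 0 r) =
      measure lebesgue (free_cone V \<inter> cball 0 s) - measure lebesgue (free_cone V \<inter> cball 0 r)"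
    unfolding eq using lm assms by (intro measurable_measure_Diff) (auto intro: fmeasurableD)
  then show ?eq
    using assms meas[of s] meas[of r] by (simp add: algebra_simps)
qed

text \<open>Each point \<open>x\<close> is assigned to a nearest centre \<open>p\<close>. For a ball
  touching \<open>p\<close> in direction \<open>v\<close>, its centre is no nearer to
  \<open>x\<close>, which gives y . v at most 1, and |y| > 2 makes this less than |y| / 2.\<close>

lemma union_balls_shell:
  assumes P: "unit_ball_packing P"
  shows "(\<Union>p\<in>P. cball p s) - (\<Union>p\<in>P. cball p 2)
    \<subseteq> (\<Union>p\<in>P. (+) p ` (free_cone (contact_directions P p) \<inter> cball 0 s - cball 0 2))"
proof
  fix x assume x: "x \<in> (\<Union>p\<in>P. cball p s) - (\<Union>p\<in>P. cball p 2)"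
  have fin: "finite P" and ne: "P \<noteq> {}"
    using P x by (auto simp: unit_ball_packing_def)
  obtain p where p: "p \<in> P" "\<And>q. q \<in> P \<Longrightarrow> dist p x \<le> dist q x"
    using arg_min_if_finite[OF fin ne, of "\<lambda>p. dist p x"] by (metis not_le)
  define y where "y = x - p"
  have "norm y = dist p x"
    by (simp add: y_def dist_norm norm_minus_commute)
  have y2: "norm y > 2"
    using x p(1) \<open>norm y = dist p x\<close> by auto
  obtain q where "q \<in> P" "dist q x \<le> s"
    using x by auto
  then have ys: "norm y \<le> s"
    using p(2)[of q] \<open>norm y = dist p x\<close> by linarith
  have "y \<in> free_cone (contact_directions P p)"
    unfolding free_cone_def
  proof (intro CollectI conjI ballI)
    show "y \<noteq> 0"
      using y2 by auto
    fix v assume "v \<in> contact_directions P p"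
    then obtain q where q: "q \<in> P" "dist p q = 2" "v = (1/2) *\<^sub>R (q - p)"
      by (auto simp: contact_directions_def contacts_def)
    have "norm v = 1"
      using q(2) by (simp add: q(3) dist_norm norm_minus_commute)
    then have v: "v \<bullet> v = 1"
      by (simp add: norm_eq_1)
    have "norm y \<le> norm (y - 2 *\<^sub>R v)"
      using p(2)[OF q(1)] \<open>norm y = dist p x\<close> by (simp add: q(3) y_def dist_norm norm_minus_commute)
    then have "(norm y)\<^sup>2 \<le> (norm (y - 2 *\<^sub>R v))\<^sup>2"
      by (intro power_mono) auto
    then have "y \<bullet> v \<le> v \<bullet> v"
      unfolding power2_norm_eq_inner by (simp add: inner_diff_left inner_diff_right inner_commute)
    with v y2 show "y \<bullet> v < norm y / 2"
      by linarith
  qed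
  then have "y \<in> free_cone (contact_directions P p) \<inter> cball 0 s - cball 0 2"
    using y2 ys by simp
  moreover have "x = p + y"
    by (simp add: y_def)
  ultimately show "x \<in> (\<Union>p\<in>P. (+) p ` (free_cone (contact_directions P p) \<inter> cball 0 s - cball 0 2))"
    using p(1) by blast
qed

text \<open>The disjoint open unit balls already fill this volume.\<close>

lemma measure_union_balls_ge:
  assumes P: "unit_ball_packing P"
  shows "real (card P) * (4/3 * pi) \<le> measure lborel (\<Union>p\<in>P. cball p 2)"
proof -
  have fin: "finite P"
    using P by (simp add: unit_ball_packing_def)
  have "real (card P) * (4/3 * pi) = (\<Sum>p\<in>P. measure lebesgue (ball p 1))"
    by (simp add: content_ball unit_ball_vol_3)
  also have "\<dots> = measure lebesgue (\<Union>p\<in>P. ball p 1)"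
    using P fin
    by (intro measure_negligible_finite_Union_image[symmetric]) (auto simp: pairwise_def unit_ball_packing_def)
  also have "\<dots> \<le> measure lebesgue (\<Union>p\<in>P. cball p 2)"
  proof (rule measure_mono_fmeasurable)
    show "(\<Union>p\<in>P. ball p 1) \<subseteq> (\<Union>p\<in>P. cball p 2)"
      by (intro UN_mono) (auto simp: less_imp_le)
    show "(\<Union>p\<in>P. ball p 1) \<in> sets lebesgue"
      by (intro sets_completionI_sets) (simp add: open_UN)
    show "(\<Union>p\<in>P. cball p 2) \<in> lmeasurable"
      using fin by (intro lmeasurable_compact compact_UN) auto
  qed
  also have "\<dots> = measure lborel (\<Union>p\<in>P. cball p 2)"
    using fin by (intro measure_completion) (simp add: closed_UN)
  finally show ?thesis .
qed

text \<open>Compares two estimates of the volume gained between radius 2 and 2.1: Brunn-Minkowski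
  from below, the exposed cones from above.\<close>

lemma contact_number_bound:
  assumes P: "unit_ball_packing P" and "P \<noteq> {}"
  shows "3/10 * real (card P) powr (2/3) \<le> 21437/100000 * (12 * real (card P) - 2 * real (contact_number P))"
proof -
  define n where "n = card P"
  have fin: "finite P"
    using P by (simp add: unit_ball_packing_def)
  have "n > 0"
    using assms fin by (simp add: n_def card_gt_0_iff)
  define U where "U r = (\<Union>p\<in>P. cball p r)" for r :: real
  have compact: "compact (U r)" for r
    unfolding U_def using fin by (intro compact_UN) auto
  have U: "U r \<in> sets borel" "bounded (U r)" "U r \<in> lmeasurable" for r
    using compact[of r] by (auto intro: compact_imp_bounded borel_compact lmeasurable_compact)
  have Um: "measure lebesgue (U r) = measure lborel (U r)" for r
    using U(1) by (intro measure_completion) simp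
  let ?b = "root 3 (4/3 * pi)"
  define a where "a = root 3 (measure lborel (U 2))"
  have V: "real n * (4/3 * pi) \<le> measure lborel (U 2)"
    using measure_union_balls_ge[OF P] by (simp add: U_def n_def)
  have pos: "0 < real n * (4/3 * pi)"
    using \<open>n > 0\<close> by simp
  have b: "?b > 0" "?b ^ 3 = 4/3 * pi"
    by (simp_all del: real_root_mult)
  have a3: "a ^ 3 = measure lborel (U 2)"
    unfolding a_def by (rule real_root_pow_pos2) auto
  have "root 3 (real n) * ?b \<le> a"
    using V unfolding a_def real_root_mult[symmetric] by simp
  then have "(root 3 (real n) * ?b)\<^sup>2 * ?b \<le> a\<^sup>2 * ?b"
    using b by (intro mult_right_mono power_mono) auto
  moreover have "(root 3 (real n) * ?b)\<^sup>2 * ?b = (root 3 (real n))\<^sup>2 * ?b ^ 3"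
    by algebra
  moreover have "(root 3 (real n))\<^sup>2 = real n powr (2/3)"
    using \<open>n > 0\<close> by (simp add: root_powr_inverse powr_power)
  ultimately have ab: "real n powr (2/3) * (4/3 * pi) \<le> a\<^sup>2 * ?b"
    by (simp only: b(2))
  have "(a + 1/10 * ?b) ^ 3 \<le> measure lborel (U (21/10))"
    unfolding a_def
  proof (rule brunn_minkowski_ball)
    show "0 < measure lborel (U 2)"
      using V pos by linarith
    fix x v :: "real^3" assume "x \<in> U 2" "norm v \<le> 1/10"
    then obtain p where p: "p \<in> P" "dist p x \<le> 2"
      by (auto simp: U_def)
    have "dist p (x + v) \<le> dist p x + dist x (x + v)"
      by (rule dist_triangle)
    also have "\<dots> \<le> 21/10"
      using p \<open>norm v \<le> 1/10\<close> by (simp add: dist_norm)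
    finally show "x + v \<in> U (21/10)"
      using p(1) by (auto simp: U_def)
  qed (use U in auto)
  \<comment> \<open>Only the first-order term is kept; \<open>a\<close> is at least the cube root of
    \<open>n\<close> times \<open>?b\<close>, which yields the 3/10 of the claim.\<close>
  moreover have "(a + 1/10 * ?b) ^ 3 = a ^ 3 + 3/10 * (a\<^sup>2 * ?b) + (3/100 * a * ?b\<^sup>2 + 1/1000 * ?b ^ 3)"
    by algebra
  moreover have "0 \<le> 3/100 * a * ?b\<^sup>2 + 1/1000 * ?b ^ 3"
    using b by (simp add: a_def)
  ultimately have lower: "3/10 * (real n powr (2/3) * (4/3 * pi)) \<le> measure lborel (U (21/10)) - measure lborel (U 2)"
    using ab a3 by linarith
  let ?S = "\<lambda>p. free_cone (contact_directions P p) \<inter> cball 0 (21/10) - cball 0 2"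
  have conf: "kissing_configuration (contact_directions P p)" for p
    using P by (rule kissing_configuration_contact_directions)
  \<comment> \<open>The factor is 2.1^3 - 2^3 = 1.261; times 17/100 it becomes the 21437/100000
    below.\<close>
  have Sm: "?S p \<in> lmeasurable"
    and S: "measure lebesgue (?S p) = 1261/1000 * measure lebesgue (free_cone (contact_directions P p) \<inter> cball 0 1)" for p
    using measure_free_cone_shell[of "contact_directions P p" 2 "21/10"] kissing_configuration.finite[OF conf[of p]]
    by (simp_all add: power3_eq_cube)
  have "measure lborel (U (21/10)) - measure lborel (U 2) = measure lebesgue (U (21/10) - U 2)"
    unfolding Um[symmetric] using U
    by (intro measurable_measure_Diff[symmetric]) (auto intro: fmeasurableD simp: U_def)
  also have "\<dots> \<le> measure lebesgue (\<Union>p\<in>P. (+) p ` ?S p)"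
    using union_balls_shell[OF P, of "21/10"] U Sm fin unfolding U_def
    by (intro measure_mono_fmeasurable fmeasurable.finite_UN measurable_translation) (auto intro: fmeasurableD)
  also have "\<dots> \<le> (\<Sum>p\<in>P. measure lebesgue ((+) p ` ?S p))"
    using fin Sm by (intro measure_UNION_le) (auto intro!: fmeasurableD measurable_translation)
  also have "\<dots> = (\<Sum>p\<in>P. 1261/1000 * measure lebesgue (free_cone (contact_directions P p) \<inter> cball 0 1))"
    by (simp only: measure_translation S)
  also have "\<dots> \<le> (\<Sum>p\<in>P. 1261/1000 * (17/100 * (12 - real (card (contacts P p))) * (4/3 * pi)))"
    using kissing_configuration.measure_free_cone_le[OF conf]
    by (intro sum_mono mult_left_mono) (auto simp: card_contact_directions)
  also have "\<dots> = 21437/100000 * (4/3 * pi) * (\<Sum>p\<in>P. 12 - real (card (contacts P p)))"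
    unfolding sum_distrib_left by (intro sum.cong refl) algebra
  also have "(\<Sum>p\<in>P. 12 - real (card (contacts P p))) = 12 * real n - 2 * real (contact_number P)"
    using sum_card_contacts[OF fin] by (simp add: sum_subtractf n_def flip: of_nat_sum)
  finally have "3/10 * (real n powr (2/3) * (4/3 * pi)) \<le>
      21437/100000 * (4/3 * pi) * (12 * real n - 2 * real (contact_number P))"
    using lower by (rule order_trans[rotated])
  then have "(4/3 * pi) * (3/10 * real n powr (2/3)) \<le>
      (4/3 * pi) * (21437/100000 * (12 * real n - 2 * real (contact_number P)))"
    by (simp only: mult_ac)
  then show ?thesis
    unfolding n_def by (rule mult_left_le_imp_le) simp
qed

text \<open>Solving for the contact number gives the coefficient 30000/42874, about 0.6997; the
  slack above 0.695 makes the inequality strict.\<close>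

lemma contact_number_less:
  assumes "unit_ball_packing P" "P \<noteq> {}"
  shows "real (contact_number P) < 6 * real (card P) - 0.695 * real (card P) powr (2/3)"
proof -
  have "real (card P) powr (2/3) > 0"
    using assms by (simp add: unit_ball_packing_def)
  moreover have "30000 * real (card P) powr (2/3) \<le> 257244 * real (card P) - 42874 * real (contact_number P)"
    using contact_number_bound[OF assms] by (simp add: field_simps)
  ultimately have "real (contact_number P) < 6 * real (card P) - 139/200 * real (card P) powr (2/3)"
    by linarith
  then show ?thesis
    by simp
qed

text \<open>Collinear centres at spacing 2 show that the maximum defining \<open>C\<close> is over a
  nonempty set.\<close>

lemma ex_unit_ball_packing: "\<exists>P. unit_ball_packing P \<and> card P = n"
proof -
  define f where "f k = (2 * real k) *\<^sub>R (axis 1 1 :: real^3)" for k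
  have d: "dist (f i) (f j) \<ge> 2" if "i \<noteq> j" for i j
  proof -
    have "dist (f i) (f j) = \<bar>2 * real i - 2 * real j\<bar>"
      by (simp add: f_def dist_norm norm_axis_1 flip: scaleR_diff_left)
    then show ?thesis
      using that by linarith
  qed
  have "inj f"
    using d by (intro injI) force
  moreover have "unit_ball_packing (f ` {..<n})"
    unfolding unit_ball_packing_def
  proof (intro conjI ballI impI)
    fix p q assume "p \<in> f ` {..<n}" "q \<in> f ` {..<n}" "p \<noteq> q"
    then obtain i j where "p = f i" "q = f j" "i \<noteq> j"
      by blast
    then have "dist p q \<ge> 2"
      using d by simp
    then show "ball p 1 \<inter> ball q 1 = {}"
      by (intro disjoint_ballI) auto
  qed simp
  ultimately show ?thesis
    by (intro exI[of _ "f ` {..<n}"]) (simp add: card_image inj_on_subset[of f UNIV])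
qed

theorem theorem1:
  fixes n :: nat
  assumes "n \<ge> 2"
  shows "real (C n) < 6 * real n - 0.695 * real n powr (2/3)"
proof -
  let ?S = "{contact_number P | P. unit_ball_packing P \<and> card P = n}"
  have bound: "real c < 6 * real n - 0.695 * real n powr (2/3)" if "c \<in> ?S" for c
    using that contact_number_less assms by force
  \<comment> \<open>A uniform bound makes the set of contact numbers finite, so that its maximum is
    attained by a packing.\<close>
  have "c \<le> 6 * n" if "c \<in> ?S" for c
  proof -
    have "real c < 6 * real n - 0.695 * real n powr (2/3)"
      using bound[OF that] .
    also have "\<dots> \<le> real (6 * n)"
      by simp
    finally show ?thesis
      by linarith
  qed
  then have "finite ?S"
    by (meson finite_nat_set_iff_bounded_le)
  moreover have "?S \<noteq> {}"
    using ex_unit_ball_packing[of n] by blast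
  ultimately have "C n \<in> ?S"
    unfolding C_def by (rule Max_in)
  then show ?thesis
    by (rule bound)
qed

end
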